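(* Let $E$ be a Banach space containing no copy of $\ell_1$ and let $F$ be a closed infinite dimensional subspace of $E^*$. Then the set $$\mathcal{C} = \{(x_j^* )_{j=1}^\infty \in \ell_\infty(F) : (x_j^* )_{j=1}^\infty \text{ is weak}^*\text{-null in } E^* \text{ and does not converge to } 0 \text{ in norm}\}$$ is almost pointwise spaceable in $\ell_\infty(F)$.
   Context: Banach spaces are real or complex; $E^*$ is the topological dual of $E$. "$E$ contains no copy of $\ell_1$" means that no subspace of $E$ is isomorphic to $\ell_1$. $\ell_\infty(F)$ is the Banach space of bounded $F$-valued sequences with the supremum norm, $F$ carrying the norm of $E^*$. A Banach sequence space is a linear subspace of $E^{\mathbb{N}}$, for some Banach space $E$, endowed with a complete norm. A nonempty subset $B$ of a Banach sequence space $X$ is almost pointwise spaceable (in $X$) if for every sequence $\mathbf{x} \in B$ there exists a closed infinite dimensional subspace of $X$ contained in $B \cup \{0\}$ and containing a subsequence of $\mathbf{x}$. *)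

theory Defs
  imports "HOL-Analysis.Analysis"
begin

section \<open>Real or complex scalars\<close>

text \<open>The scalar field is a type \<open>'k\<close> that is, up to an isometric field isomorphism,
  either the reals or the complex numbers.\<close>

class real_or_complex = real_normed_field + banach +
  assumes real_or_complex:
    "\<exists>\<phi> :: 'a \<Rightarrow> complex.
        (\<forall>x y. \<phi> (x + y) = \<phi> x + \<phi> y) \<and> (\<forall>x y. \<phi> (x * y) = \<phi> x * \<phi> y) \<and>
        (\<forall>x. cmod (\<phi> x) = norm x) \<and> (range \<phi> = \<real> \<or> range \<phi> = UNIV)"

instance real :: real_or_complex
  by standard (rule exI[where x = complex_of_real], auto simp: Reals_def)

instance complex :: real_or_complex
  by standard (rule exI[where x = "\<lambda>z. z"], auto)

text \<open>A Banach space over \<open>'k\<close> is a type of class \<^class>\<open>banach\<close> with a scalar multiplication by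
  \<open>'k\<close> that extends the real one. For \<open>'k = real\<close> the scalar multiplication is necessarily
  \<^const>\<open>scaleR\<close>.\<close>

locale banach_space_over = vector_space scl
  for scl :: "'k::real_or_complex \<Rightarrow> 'e::banach \<Rightarrow> 'e" +
  assumes norm_scl: "norm (scl c x) = norm c * norm x"
    and scl_of_real: "scl (of_real r) x = r *\<^sub>R x"


section \<open>Closed infinite dimensional subspaces\<close>

definition closed_subspace_of ::
    "('k::field \<Rightarrow> 'v::real_normed_vector \<Rightarrow> 'v) \<Rightarrow> 'v set \<Rightarrow> 'v set \<Rightarrow> bool" where
  "closed_subspace_of scl V W \<longleftrightarrow>
     module.subspace scl W \<and> W \<subseteq> V \<and> closedin (top_of_set V) W"

definition infinite_dimensional ::
    "('k::field \<Rightarrow> 'v::ab_group_add \<Rightarrow> 'v) \<Rightarrow> 'v set \<Rightarrow> bool" where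
  "infinite_dimensional scl W \<longleftrightarrow> \<not> (\<exists>S. finite S \<and> W \<subseteq> module.span scl S)"


section \<open>Copies of \<open>\<ell>\<^sub>1\<close>\<close>

definition l1 :: "(nat \<Rightarrow> 'k::real_normed_field) set" where
  "l1 = {a. summable (\<lambda>n. norm (a n))}"

definition l1_norm :: "(nat \<Rightarrow> 'k::real_normed_field) \<Rightarrow> real" where
  "l1_norm a = (\<Sum>n. norm (a n))"

definition contains_copy_of_l1 ::
    "('k::real_normed_field \<Rightarrow> 'e::real_normed_vector \<Rightarrow> 'e) \<Rightarrow> bool" where
  "contains_copy_of_l1 scl \<longleftrightarrow>
     (\<exists>V T. module.subspace scl V \<and> bij_betw T l1 V \<and>
        (\<forall>a\<in>l1. \<forall>b\<in>l1. T (\<lambda>n. a n + b n) = T a + T b) \<and>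
        (\<forall>c. \<forall>a\<in>l1. T (\<lambda>n. c * a n) = scl c (T a)) \<and>
        (\<exists>K. \<forall>a\<in>l1. norm (T a) \<le> K * l1_norm a) \<and>
        (\<exists>K. \<forall>a\<in>l1. l1_norm a \<le> K * norm (T a)))"


section \<open>The dual space\<close>

text \<open>The elements of \<open>'e \<Rightarrow>\<^sub>L 'k\<close> are the bounded real-linear maps; the dual consists of those
  that are linear over \<open>'k\<close>, with the operator norm.\<close>

definition dual_space ::
    "('k::real_or_complex \<Rightarrow> 'e::banach \<Rightarrow> 'e) \<Rightarrow> ('e \<Rightarrow>\<^sub>L 'k) set" where
  "dual_space scl = {f. \<forall>c x. blinfun_apply f (scl c x) = c * blinfun_apply f x}"

definition dual_scale ::
    "'k::real_or_complex \<Rightarrow> ('e::banach \<Rightarrow>\<^sub>L 'k) \<Rightarrow> ('e \<Rightarrow>\<^sub>L 'k)" where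
  "dual_scale c f = blinfun_mult_right c o\<^sub>L f"

lemma dual_scale_apply [simp]: "blinfun_apply (dual_scale c f) x = c * blinfun_apply f x"
  by (simp add: dual_scale_def)

lemma vector_space_dual_scale: "vector_space dual_scale"
  by unfold_locales (auto intro!: blinfun_eqI simp: algebra_simps blinfun.add_left)

lemma norm_dual_scale_le: "norm (dual_scale c f) \<le> norm c * norm f"
proof (rule norm_blinfun_bound)
  fix x
  have "norm (blinfun_apply (dual_scale c f) x) = norm c * norm (blinfun_apply f x)"
    by (simp add: norm_mult)
  also have "\<dots> \<le> norm c * (norm f * norm x)"
    by (intro mult_left_mono norm_blinfun) simp
  finally show "norm (blinfun_apply (dual_scale c f) x) \<le> norm c * norm f * norm x"
    by (simp add: mult.assoc)
qed simp

text \<open>For functionals the strong operator topology, the topology of pointwise convergence, is the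
  weak* topology.\<close>

definition weak_star_topology ::
    "('k::real_or_complex \<Rightarrow> 'e::banach \<Rightarrow> 'e) \<Rightarrow> ('e \<Rightarrow>\<^sub>L 'k) topology" where
  "weak_star_topology scl = subtopology strong_operator_topology (dual_space scl)"


section \<open>Bounded sequences and almost pointwise spaceability\<close>

text \<open>As \<^typ>\<open>nat\<close> is discrete, \<open>nat \<Rightarrow>\<^sub>C 'v\<close> is the space of all bounded \<open>'v\<close>-valued sequences
  with the supremum norm.\<close>

definition linf :: "'v::real_normed_vector set \<Rightarrow> (nat \<Rightarrow>\<^sub>C 'v) set" where
  "linf F = {x. range (apply_bcontfun x) \<subseteq> F}"

definition linf_scale ::
    "'k::real_or_complex \<Rightarrow> (nat \<Rightarrow>\<^sub>C ('e::banach \<Rightarrow>\<^sub>L 'k)) \<Rightarrow> (nat \<Rightarrow>\<^sub>C ('e \<Rightarrow>\<^sub>L 'k))" where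
  "linf_scale c x = Bcontfun (\<lambda>j. dual_scale c (apply_bcontfun x j))"

lemma linf_scale_apply [simp]:
  "apply_bcontfun (linf_scale c x) j = dual_scale c (apply_bcontfun x j)"
proof -
  have "norm (dual_scale c (apply_bcontfun x i)) \<le> norm c * norm x" for i
    using norm_dual_scale_le[of c "apply_bcontfun x i"]
      mult_left_mono[OF norm_bounded[of x i], of "norm c"] by simp
  then have "(\<lambda>i. dual_scale c (apply_bcontfun x i)) \<in> bcontfun"
    by (intro bcontfun_normI) auto
  then show ?thesis
    by (simp add: linf_scale_def Bcontfun_inverse)
qed

lemma vector_space_linf_scale: "vector_space linf_scale"
proof -
  interpret vector_space dual_scale by (rule vector_space_dual_scale)
  show ?thesis
    by unfold_locales (auto intro!: bcontfun_eqI simp: algebra_simps)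
qed

text \<open>A Banach sequence space is given by a subset \<open>X\<close> of a normed space \<open>'x\<close> together with the map
  \<open>coord\<close> that sends an element of \<open>X\<close> to the sequence of its terms. Being a nonempty subset of
  \<open>X\<close> is part of the definition.\<close>

definition almost_pointwise_spaceable ::
    "('k::field \<Rightarrow> 'x::real_normed_vector \<Rightarrow> 'x) \<Rightarrow> ('x \<Rightarrow> nat \<Rightarrow> 'v) \<Rightarrow> 'x set \<Rightarrow> 'x set \<Rightarrow> bool"
  where
  "almost_pointwise_spaceable scl coord X B \<longleftrightarrow>
     B \<noteq> {} \<and> B \<subseteq> X \<and>
     (\<forall>x\<in>B. \<exists>W. closed_subspace_of scl X W \<and> infinite_dimensional scl W \<and>
        W \<subseteq> B \<union> {0} \<and>
        (\<exists>w\<in>W. \<exists>r :: nat \<Rightarrow> nat. strict_mono r \<and> coord w = coord x \<circ> r))"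

end

theory Submission
  imports Defs "HOL-Library.Diagonal_Subsequence"
begin

text \<open>The statement has two halves of very different depth.

\<^emph>\<open>Passing from one sequence to a subspace.\<close> Let \<open>x\<close> be weak*-null
  and not norm-null, and let \<open>y\<close> be a subsequence of \<open>x\<close> whose norms stay
  above some \<open>\<epsilon> > 0\<close>. Split the indices into infinitely many infinite classes
  and multiply \<open>y\<close> by scalar sequences that are constant on each class. A bounded
  multiple of a weak*-null sequence is weak*-null; a nonzero multiple repeats a nonzero factor
  infinitely often and so cannot tend to \<open>0\<close> in norm. These multiples form a closed
  subspace, it is infinite dimensional because there are infinitely many classes, and the constant
  multiplier \<open>1\<close> gives \<open>y\<close> itself (\<open>spaceable_subsequence\<close>).

\<^emph>\<open>Nonemptiness.\<close> It remains to find in \<open>F\<close> one bounded weak*-null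
  sequence that is bounded below in norm; here the absence of copies of
  \<open>\<ell>\<^sub>1\<close> enters. Since no finite set of vectors separates the points of
  \<open>F\<close>, there is a separated sequence of norm one functionals in \<open>F\<close>. By
  Rosenthal's dichotomy, applied to their real parts as functions on the unit ball, some subsequence
  either converges pointwise, and then consecutive differences do the job, or is Boolean
  independent, and then satisfies a lower \<open>\<ell>\<^sub>1\<close>-estimate with real
  coefficients. In the second case follow Hagler and Johnson: consider the successive blocks
  \<open>w\<^sub>n = \<Sum> a\<^sub>i y\<^sub>i\<close> with \<open>\<Sum> \<bar>a\<^sub>i\<bar> =
  1\<close>. They lie in \<open>F\<close> and stay bounded below, so it suffices that one block
  sequence is weak*-null. The quantity \<open>\<delta>(w) = sup {limsup \<bar>w\<^sub>n x\<bar> | x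
  in the ball}\<close> can only decrease when blocks are taken, and a diagonal argument gives a
  \<open>d\<close> on whose blocks it is constant. If \<open>\<delta>(d) = 0\<close>, then
  \<open>d\<close> is weak*-null. If \<open>\<delta>(d) = \<delta> > 0\<close>, consider the block
  whose terms are averages of signed terms of \<open>d\<close>. At some \<open>x\<close> it still
  comes close to \<open>\<delta>\<close> infinitely often, while no late term of \<open>d\<close> exceeds
  \<open>\<delta>\<close> by much there; so every single term in such an average must be near
  \<open>\<plusminus>\<delta>\<close> with the prescribed sign. Repeating this along a dyadic tree
  of index sets yields vectors \<open>x\<^sub>1, x\<^sub>2, \<dots>\<close> in the ball on which the
  \<open>d\<^sub>k\<close> realise all sign patterns up to a small error, which makes them span a
  copy of \<open>\<ell>\<^sub>1\<close> in \<open>E\<close>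
  (\<open>weak_star_null_l1_block\<close>).\<close>

section \<open>Real parts and rotations of scalars\<close>

text \<open>An isometric additive map that fixes \<open>1\<close> fixes every real \<open>r\<close>: its value at \<open>r\<close> has the distances
  \<open>\<bar>r\<bar>\<close> and \<open>\<bar>r - 1\<bar>\<close> from \<open>0\<close> and \<open>1\<close>, and the two circles with these radii touch at \<open>r\<close>.\<close>

lemma scalar_embedding:
  obtains \<phi> :: "'k::real_or_complex \<Rightarrow> complex"
  where "linear \<phi>" and "\<And>x y. \<phi> (x * y) = \<phi> x * \<phi> y" and "\<And>x. cmod (\<phi> x) = norm x"
    and "\<And>r. \<phi> (of_real r) = complex_of_real r" and "range \<phi> = \<real> \<or> range \<phi> = UNIV"
proof -
  obtain \<phi> :: "'k \<Rightarrow> complex" where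
    add: "\<And>x y. \<phi> (x + y) = \<phi> x + \<phi> y" and mult: "\<And>x y. \<phi> (x * y) = \<phi> x * \<phi> y"
    and norm: "\<And>x. cmod (\<phi> x) = norm x" and range: "range \<phi> = \<real> \<or> range \<phi> = UNIV"
    using real_or_complex by metis
  have one: "\<phi> 1 = 1"
    using mult[of 1 1] norm[of 1] by (metis mult.left_neutral mult_cancel_right norm_one norm_zero zero_neq_one)
  have minus: "\<phi> (x - y) = \<phi> x - \<phi> y" for x y
    using add[of "x - y" y] by (simp add: algebra_simps)
  have of_real: "\<phi> (of_real r) = complex_of_real r" for r
  proof -
    let ?z = "\<phi> (of_real r)"
    have 1: "(Re ?z)\<^sup>2 + (Im ?z)\<^sup>2 = r\<^sup>2"
      using norm[of "of_real r"] by (metis cmod_power2 norm_of_real power2_abs)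
    have "cmod (?z - 1) = \<bar>r - 1\<bar>"
      using norm[of "of_real r - 1"] minus[of "of_real r" 1] one norm_of_real[of "r - 1", where ?'a='k]
      by simp
    then have "(Re ?z - 1)\<^sup>2 + (Im ?z)\<^sup>2 = (r - 1)\<^sup>2"
      using cmod_power2[of "?z - 1"] by simp
    with 1 have "Re ?z = r"
      by (simp add: power2_eq_square algebra_simps)
    with 1 show ?thesis
      by (simp add: complex_eq_iff)
  qed
  have "linear \<phi>"
    by (rule linearI) (simp_all add: add mult of_real scaleR_conv_of_real)
  then show ?thesis
    using that mult norm of_real range by blast
qed

text \<open>The real part, written through the norm by polarisation, so that it refers to no choice
  of an embedding into the complex numbers.\<close>
definition re_part :: "'k::real_or_complex \<Rightarrow> real" where
  "re_part t = ((norm t)\<^sup>2 + 1 - (norm (t - 1))\<^sup>2) / 2"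

lemma re_part_eq_Re:
  fixes \<phi> :: "'k::real_or_complex \<Rightarrow> complex"
  assumes "linear \<phi>" "\<And>x. cmod (\<phi> x) = norm x" "\<And>r. \<phi> (of_real r) = complex_of_real r"
  shows "re_part t = Re (\<phi> t)"
proof -
  have "\<phi> (t - 1) = \<phi> t - 1"
    using assms(3)[of 1] linear_diff[OF assms(1)] by simp
  then have "(norm (t - 1))\<^sup>2 = (Re (\<phi> t) - 1)\<^sup>2 + (Im (\<phi> t))\<^sup>2"
    by (metis (no_types) assms(2) cmod_power2 minus_complex.sel one_complex.sel diff_zero)
  moreover have "(norm t)\<^sup>2 = (Re (\<phi> t))\<^sup>2 + (Im (\<phi> t))\<^sup>2"
    by (metis assms(2) cmod_power2)
  ultimately show ?thesis
    by (simp add: re_part_def power2_eq_square algebra_simps)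
qed

lemma linear_re_part: "linear (re_part :: 'k::real_or_complex \<Rightarrow> real)"
proof -
  obtain \<phi> :: "'k \<Rightarrow> complex" where \<phi>: "linear \<phi>" "\<And>x. cmod (\<phi> x) = norm x"
      "\<And>r. \<phi> (of_real r) = complex_of_real r"
    using scalar_embedding by metis
  show ?thesis
    by (rule linearI) (simp_all add: re_part_eq_Re[OF \<phi>] linear_add[OF \<phi>(1)] linear_scale[OF \<phi>(1)])
qed

lemma re_part_of_real [simp]: "re_part (of_real r :: 'k::real_or_complex) = r"
proof -
  have "norm (of_real r - 1 :: 'k) = \<bar>r - 1\<bar>"
    using norm_of_real[of "r - 1", where ?'a='k] by simp
  then show ?thesis
    by (simp add: re_part_def power2_eq_square algebra_simps)
qed

lemma abs_re_part_le: "\<bar>re_part (t :: 'k::real_or_complex)\<bar> \<le> norm t"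
proof -
  obtain \<phi> :: "'k \<Rightarrow> complex" where \<phi>: "linear \<phi>" "\<And>x. cmod (\<phi> x) = norm x"
      "\<And>r. \<phi> (of_real r) = complex_of_real r"
    using scalar_embedding by metis
  show ?thesis
    using abs_Re_le_cmod[of "\<phi> t"] by (simp add: re_part_eq_Re[OF \<phi>] \<phi>(2))
qed

lemma norm_diff_of_real_power2:
  fixes t :: "'k::real_or_complex"
  shows "(norm (t - of_real s))\<^sup>2 = (norm t)\<^sup>2 - 2 * s * re_part t + s\<^sup>2"
proof -
  obtain \<phi> :: "'k \<Rightarrow> complex" where \<phi>: "linear \<phi>" "\<And>x. cmod (\<phi> x) = norm x"
      "\<And>r. \<phi> (of_real r) = complex_of_real r"
    using scalar_embedding by metis
  have "norm (t - of_real s) = cmod (\<phi> t - of_real s)"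
    by (metis \<phi> linear_diff)
  moreover have "norm t = cmod (\<phi> t)" by (simp add: \<phi>)
  ultimately show ?thesis
    by (simp add: re_part_eq_Re[OF \<phi>] cmod_power2) (simp add: power2_eq_square algebra_simps)
qed

text \<open>For complex scalars \<open>j\<close> is the imaginary unit, for real ones it is
  \<open>1\<close>. In this way real and complex spaces are treated together: control of the real
  parts of \<open>t\<close> and \<open>j * t\<close> is control of \<open>t\<close>.\<close>
lemma norm_le_re_parts:
  obtains j :: "'k::real_or_complex"
  where "norm j = 1" "\<And>t. norm t \<le> \<bar>re_part t\<bar> + \<bar>re_part (j * t)\<bar>"
proof -
  obtain \<phi> :: "'k \<Rightarrow> complex" where \<phi>: "linear \<phi>" "\<And>x. cmod (\<phi> x) = norm x"
      "\<And>r. \<phi> (of_real r) = complex_of_real r" and mult: "\<And>x y. \<phi> (x * y) = \<phi> x * \<phi> y"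
    and range: "range \<phi> = \<real> \<or> range \<phi> = UNIV"
    using scalar_embedding by metis
  note re = re_part_eq_Re[OF \<phi>]
  from range show ?thesis
  proof
    assume r: "range \<phi> = \<real>"
    have "norm t \<le> \<bar>re_part t\<bar> + \<bar>re_part (1 * t)\<bar>" for t :: 'k
    proof -
      have "\<phi> t \<in> \<real>" using r by auto
      then show ?thesis
        unfolding re \<phi>(2)[symmetric] by (auto simp: Reals_def)
    qed
    then show ?thesis by (intro that[of 1]) auto
  next
    assume r: "range \<phi> = UNIV"
    then obtain j where j: "\<phi> j = \<i>" by (metis surjD)
    have "norm t \<le> \<bar>re_part t\<bar> + \<bar>re_part (j * t)\<bar>" for t :: 'k
      unfolding re \<phi>(2)[symmetric] mult j using cmod_le by simp
    moreover have "norm j = 1" using \<phi>(2)[of j] j by simp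
    ultimately show ?thesis by (intro that)
  qed
qed

lemma bounded_scalar_sequence_convergent_subsequence:
  fixes t :: "nat \<Rightarrow> 'k::real_or_complex"
  assumes "\<And>n. norm (t n) \<le> C"
  obtains r l where "strict_mono (r :: nat \<Rightarrow> nat)" "(t \<circ> r) \<longlonglongrightarrow> l"
proof -
  obtain \<phi> :: "'k \<Rightarrow> complex" where \<phi>: "linear \<phi>" "\<And>x. cmod (\<phi> x) = norm x"
    using scalar_embedding by metis
  have "bounded (range (\<phi> \<circ> t))"
    using assms by (intro boundedI[of _ C]) (auto simp: \<phi>)
  then obtain l r where r: "strict_mono (r :: nat \<Rightarrow> nat)" "((\<phi> \<circ> t) \<circ> r) \<longlonglongrightarrow> l"
    using bounded_imp_convergent_subsequence by blast
  have "Cauchy (t \<circ> r)"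
  proof (rule metric_CauchyI)
    fix e :: real assume "e > 0"
    then obtain M where "\<And>m n. m \<ge> M \<Longrightarrow> n \<ge> M \<Longrightarrow> dist (\<phi> (t (r m))) (\<phi> (t (r n))) < e"
      using metric_CauchyD[OF LIMSEQ_imp_Cauchy[OF r(2)], of e] by auto
    moreover have "dist (\<phi> x) (\<phi> y) = dist x y" for x y
      by (simp add: dist_norm \<phi> flip: linear_diff[OF \<phi>(1)])
    ultimately show "\<exists>M. \<forall>m\<ge>M. \<forall>n\<ge>M. dist ((t \<circ> r) m) ((t \<circ> r) n) < e"
      by auto
  qed
  then show ?thesis
    using that r(1) Cauchy_convergent_iff convergent_def by metis
qed

text \<open>The scalars need not have convergent arguments, but by compactness they do along a
  subsequence, and then one rotation serves infinitely many indices at once.\<close>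
lemma rotation_to_real_axis:
  fixes t :: "nat \<Rightarrow> 'k::real_or_complex"
  assumes bound: "\<And>n. norm (t n) \<le> C" and N: "infinite N" and large: "\<And>n. n \<in> N \<Longrightarrow> p \<le> norm (t n)"
    and "0 < \<eta>"
  obtains c N' where "norm c = 1" "N' \<subseteq> N" "infinite N'" "\<And>n. n \<in> N' \<Longrightarrow> p - \<eta> \<le> re_part (c * t n)"
proof -
  obtain e :: "nat \<Rightarrow> nat" where e: "strict_mono e" "\<And>n. e n \<in> N"
    using infinite_enumerate[OF N] by auto
  obtain r l where r: "strict_mono (r :: nat \<Rightarrow> nat)" and l: "(t \<circ> e \<circ> r) \<longlonglongrightarrow> l"
    using bounded_scalar_sequence_convergent_subsequence[of "t \<circ> e" C] bound by auto
  have "p \<le> norm l"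
    using LIMSEQ_le_const[OF tendsto_norm[OF l]] large e(2) by auto
  define c where "c = (if l = 0 then 1 else of_real (norm l) / l)"
  have c: "norm c = 1" "c * l = of_real (norm l)"
    by (auto simp: c_def norm_divide)
  obtain n0 where n0: "\<And>n. n \<ge> n0 \<Longrightarrow> norm (t (e (r n)) - l) < \<eta>"
    using LIMSEQ_D[OF l \<open>0 < \<eta>\<close>] by auto
  have "p - \<eta> \<le> re_part (c * t (e (r n)))" if "n \<ge> n0" for n
  proof -
    have "re_part (c * t (e (r n))) = re_part (c * l) + re_part (c * (t (e (r n)) - l))"
      by (simp add: linear_add[OF linear_re_part, symmetric] algebra_simps)
    moreover have "\<bar>re_part (c * (t (e (r n)) - l))\<bar> < \<eta>"
      using abs_re_part_le[of "c * (t (e (r n)) - l)"] n0[OF that] by (simp add: norm_mult c)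
    ultimately show ?thesis
      using \<open>p \<le> norm l\<close> by (simp add: c(2))
  qed
  moreover have "infinite ((e \<circ> r) ` {n0..})"
    using strict_mono_imp_inj_on[OF strict_mono_o[OF e(1) r]]
    by (metis finite_imageD infinite_Ici inj_on_subset subset_UNIV)
  ultimately show ?thesis
    using that[of c "(e \<circ> r) ` {n0..}"] e(2) c(1) by auto
qed

section \<open>Boolean independent sequences and Rosenthal's dichotomy\<close>

text \<open>A tree construction used twice: for Rosenthal's dichotomy (points are vectors, choices
  are indices) and for the copy of \<open>\<ell>\<^sub>1\<close> (points are indices, choices are
  vectors). The family \<open>\<S>\<close> is the current level of the tree. Each choice
  \<open>c\<close> splits every node into a part inside \<open>A c\<close> and a part inside
  \<open>B c\<close>, and as the nodes never become empty, every pattern of decisions is realised by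
  a point. The state \<open>s\<close> carries the further data that the construction maintains;
  \<open>R\<close> records how it may change.\<close>
lemma independent_sequence:
  fixes G :: "'p set set \<Rightarrow> 's \<Rightarrow> bool" and A B :: "'c \<Rightarrow> 'p set"
  assumes start: "G \<S>0 s0" "\<S>0 \<noteq> {}"
    and nonempty: "\<And>\<S> s S. G \<S> s \<Longrightarrow> S \<in> \<S> \<Longrightarrow> S \<noteq> {}"
    and step: "\<And>\<S> s. G \<S> s \<Longrightarrow> \<exists>c \<T> t. G \<T> t \<and> R s c t \<and>
        (\<forall>S\<in>\<S>. (\<exists>T\<in>\<T>. T \<subseteq> S \<inter> A c) \<and> (\<exists>T\<in>\<T>. T \<subseteq> S \<inter> B c))"
  obtains c s where "\<And>j. R (s j) (c j) (s (Suc j))"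
    "\<And>N \<sigma>. \<exists>S\<in>\<S>0. \<exists>p\<in>S. \<forall>j<N. p \<in> (if \<sigma> j then A (c j) else B (c j))"
proof -
  let ?P = "\<lambda>n::nat. \<lambda>(\<S>, s). G \<S> s \<and> (n = 0 \<longrightarrow> \<S> = \<S>0 \<and> s = s0)"
  let ?Q = "\<lambda>(\<S>, s) (\<T>, t). \<exists>c. R s c t \<and>
        (\<forall>S\<in>\<S>. (\<exists>T\<in>\<T>. T \<subseteq> S \<inter> A c) \<and> (\<exists>T\<in>\<T>. T \<subseteq> S \<inter> B c))"
  have "\<exists>f. \<forall>n. ?P n (f n) \<and> ?Q (f n) (f (Suc n))"
  proof (rule dependent_nat_choice)
    show "\<exists>x. ?P 0 x" using start by auto
    show "\<exists>y. ?P (Suc n) y \<and> ?Q x y" if "?P n x" for x n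
    proof -
      obtain \<S> s where x: "x = (\<S>, s)" by fastforce
      with that have "G \<S> s" by simp
      from step[OF this] obtain c \<T> t where "G \<T> t \<and> R s c t \<and>
        (\<forall>S\<in>\<S>. (\<exists>T\<in>\<T>. T \<subseteq> S \<inter> A c) \<and> (\<exists>T\<in>\<T>. T \<subseteq> S \<inter> B c))"
        by blast
      then show ?thesis
        unfolding x by (intro exI[of _ "(\<T>, t)"]) auto
    qed
  qed
  then obtain f where f': "\<forall>n. ?P n (f n) \<and> ?Q (f n) (f (Suc n))" ..
  have f: "?P n (f n)" "?Q (f n) (f (Suc n))" for n
    using spec[OF f', of n] by (rule conjunct1, rule conjunct2)
  define F s where "F n = fst (f n)" and "s n = snd (f n)" for n
  have G: "G (F n) (s n)" and init: "F 0 = \<S>0" for n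
    using f(1)[of n] f(1)[of 0] by (auto simp: F_def s_def split: prod.splits)
  have "\<exists>c. R (s n) c (s (Suc n)) \<and>
        (\<forall>S\<in>F n. (\<exists>T\<in>F (Suc n). T \<subseteq> S \<inter> A c) \<and> (\<exists>T\<in>F (Suc n). T \<subseteq> S \<inter> B c))" for n
    using f(2)[of n] by (auto simp: F_def s_def split: prod.splits)
  then obtain c where R: "\<And>n. R (s n) (c n) (s (Suc n))" and
    c: "\<And>n S. S \<in> F n \<Longrightarrow> \<exists>T\<in>F (Suc n). T \<subseteq> S \<inter> A (c n)"
       "\<And>n S. S \<in> F n \<Longrightarrow> \<exists>T\<in>F (Suc n). T \<subseteq> S \<inter> B (c n)"
    by metis
  have "\<exists>S\<in>\<S>0. \<exists>p\<in>S. \<forall>j<N. p \<in> (if \<sigma> j then A (c j) else B (c j))" for N \<sigma>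
  proof -
    have "\<exists>T\<in>F N. \<exists>S\<in>\<S>0. T \<subseteq> S \<and> (\<forall>j<N. T \<subseteq> (if \<sigma> j then A (c j) else B (c j)))"
    proof (induction N)
      case 0
      then show ?case using start init by auto
    next
      case (Suc N)
      then obtain T S where T: "T \<in> F N" "S \<in> \<S>0" "T \<subseteq> S"
          "\<forall>j<N. T \<subseteq> (if \<sigma> j then A (c j) else B (c j))"
        by blast
      obtain T' where "T' \<in> F (Suc N)" "T' \<subseteq> T \<inter> (if \<sigma> N then A (c N) else B (c N))"
        using c[OF T(1)] by (cases "\<sigma> N") auto
      then have "T' \<subseteq> S \<and> (\<forall>j<Suc N. T' \<subseteq> (if \<sigma> j then A (c j) else B (c j)))"
        using T(3,4) unfolding less_Suc_eq by blast
      then show ?case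
        using \<open>T' \<in> F (Suc N)\<close> T(2) by blast
    qed
    then obtain T S where T: "T \<in> F N" "S \<in> \<S>0" "T \<subseteq> S"
        "\<forall>j<N. T \<subseteq> (if \<sigma> j then A (c j) else B (c j))"
      by blast
    obtain p where "p \<in> T"
      using nonempty[OF G T(1)] by blast
    then show ?thesis
      using T by blast
  qed
  then show thesis
    by (rule that[of s c, OF R])
qed

text \<open>A point of \<open>S\<close> at which the sequence of pairs \<open>(A n, B n)\<close>,
  \<open>n \<in> M\<close>, fails to settle. If \<open>A n\<close> and \<open>B n\<close> are the
  sets where a function \<open>u n\<close> is large and small, respectively, the values at this
  point diverge.\<close>
definition splits :: "(nat \<Rightarrow> 'p set) \<Rightarrow> (nat \<Rightarrow> 'p set) \<Rightarrow> 'p set \<Rightarrow> nat set \<Rightarrow> bool" where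
  "splits A B S M \<longleftrightarrow> (\<exists>x\<in>S. infinite {n \<in> M. x \<in> A n} \<and> infinite {n \<in> M. x \<in> B n})"

lemma splits_almost_mono:
  assumes "splits A B S M" "finite (M - L)"
  shows "splits A B S L"
proof -
  have "infinite {n \<in> L. Q n}" if "infinite {n \<in> M. Q n}" for Q
  proof
    assume "finite {n \<in> L. Q n}"
    then have "finite ({n \<in> L. Q n} \<union> (M - L))" using assms(2) by simp
    then show False
      using that by (rule_tac notE[OF that]) (erule rev_finite_subset, auto)
  qed
  with assms(1) show ?thesis unfolding splits_def by meson
qed

definition persistently_splits ::
    "(nat \<Rightarrow> 'p set) \<Rightarrow> (nat \<Rightarrow> 'p set) \<Rightarrow> 'p set \<Rightarrow> nat set \<Rightarrow> bool" where
  "persistently_splits A B S M \<longleftrightarrow> (\<forall>L\<subseteq>M. infinite L \<longrightarrow> splits A B S L)"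

text \<open>The heart of Rosenthal's theorem. If every \<open>n\<close> failed, one could choose
  indices \<open>n k\<close> one after the other, each with one half of one \<open>S\<close> on
  which a later index set no longer splits. There are only finitely many choices of \<open>S\<close>
  and of the half, so one choice, say \<open>S\<close> with the \<open>A\<close>-half, occurs for
  infinitely many \<open>k\<close>. The set of these \<open>n k\<close> splits at some
  \<open>x\<close> in \<open>S\<close>, hence \<open>x\<close> belongs to some \<open>A (n
  k)\<close>; but on \<open>S \<inter> A (n k)\<close> the indices after \<open>n k\<close> were not
  to split.\<close>
lemma persistently_splits_refine:
  assumes "finite \<S>" and M: "infinite M" and pers: "\<And>S. S \<in> \<S> \<Longrightarrow> persistently_splits A B S M"
  shows "\<exists>n\<in>M. \<exists>M'\<subseteq>M. infinite M' \<and> (\<forall>S\<in>\<S>. persistently_splits A B (S \<inter> A n) M' \<and>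
           persistently_splits A B (S \<inter> B n) M')"
proof (rule ccontr)
  assume neg: "\<not> ?thesis"
  define C where "C b n = (if b then A n else B n)" for b n
  have ex: "\<exists>L S b. L \<subseteq> M' \<and> infinite L \<and> S \<in> \<S> \<and> \<not> splits A B (S \<inter> C b n) L"
    if "n \<in> M" "M' \<subseteq> M" "infinite M'" for n M'
  proof -
    from neg that obtain S where "S \<in> \<S>" "\<not> persistently_splits A B (S \<inter> A n) M' \<or>
           \<not> persistently_splits A B (S \<inter> B n) M'"
      by blast
    then obtain b where b: "\<not> persistently_splits A B (S \<inter> C b n) M'"
      unfolding C_def by (metis (full_types))
    with \<open>S \<in> \<S>\<close> show ?thesis unfolding persistently_splits_def by blast
  qed
  define P where "P y \<longleftrightarrow> fst y \<in> M \<and> snd y \<subseteq> M \<and> infinite (snd y) \<and> snd y \<subseteq> {fst y<..} \<and>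
      (\<exists>S\<in>\<S>. \<exists>b. \<not> splits A B (S \<inter> C b (fst y)) (snd y))" for y :: "nat \<times> nat set"
  have new: "\<exists>y. P y \<and> fst y \<in> L \<and> snd y \<subseteq> L" if L: "L \<subseteq> M" "infinite L" for L
  proof -
    obtain n where n: "n \<in> L" using L(2) by fastforce
    have "infinite (L - {..n})" using L(2) by simp
    moreover have "n \<in> M" "L - {..n} \<subseteq> M" using n L(1) by auto
    ultimately obtain L' S b where
      L': "L' \<subseteq> L - {..n}" "infinite L'" "S \<in> \<S>" "\<not> splits A B (S \<inter> C b n) L'"
      using ex[of n "L - {..n}"] by blast
    then have "L' \<subseteq> L" "L' \<subseteq> {n<..}" by auto
    then have "P (n, L')" using L' n L(1) unfolding P_def by auto
    then show ?thesis using n \<open>L' \<subseteq> L\<close> by (intro exI[of _ "(n, L')"]) simp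
  qed
  have "\<exists>f. \<forall>k::nat. P (f k) \<and> fst (f (Suc k)) \<in> snd (f k) \<and> snd (f (Suc k)) \<subseteq> snd (f k)"
  proof (rule dependent_nat_choice)
    show "\<exists>x. P x" using new[OF subset_refl M] by blast
    show "\<exists>y. P y \<and> fst y \<in> snd x \<and> snd y \<subseteq> snd x" if "P x" for x
      using that by (intro new) (auto simp: P_def)
  qed
  then obtain f where f: "\<And>k. P (f k)" "\<And>k. fst (f (Suc k)) \<in> snd (f k)"
      "\<And>k. snd (f (Suc k)) \<subseteq> snd (f k)"
    by blast
  define n L where "n k = fst (f k)" and "L k = snd (f k)" for k
  have n: "n k \<in> M" "L k \<subseteq> {n k<..}" "\<exists>S\<in>\<S>. \<exists>b. \<not> splits A B (S \<inter> C b (n k)) (L k)"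
    "n (Suc k) \<in> L k" "L (Suc k) \<subseteq> L k" for k
    using f(1)[of k] f(2)[of k] f(3)[of k] unfolding P_def n_def L_def by simp_all
  have mono: "strict_mono n"
    using n(2,4) by (subst strict_mono_Suc_iff) auto
  have later: "n i \<in> L k" if "k < i" for i k
  proof -
    have "L j \<subseteq> L k" if "k \<le> j" for j
      using that by (rule lift_Suc_antimono_le[of L, rotated]) (rule n(5))
    moreover have "n i \<in> L (i - 1)"
      using that n(4)[of "i - 1"] by simp
    ultimately show ?thesis
      using that by (metis Suc_leI diff_Suc_1 diff_le_mono subsetD)
  qed
  have "\<exists>Sb\<in>\<S> \<times> (UNIV::bool set). infinite {k\<in>UNIV. \<not> splits A B (fst Sb \<inter> C (snd Sb) (n k)) (L k)}"
    by (rule pigeonhole_infinite_rel) (use n(3) assms(1) in auto)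
  then obtain S b where S: "S \<in> \<S>" and "infinite {k. \<not> splits A B (S \<inter> C b (n k)) (L k)}"
    by auto
  define J where "J = {k. \<not> splits A B (S \<inter> C b (n k)) (L k)}"
  have J: "infinite J" unfolding J_def by fact
  have "infinite (n ` J)"
    using J mono by (simp add: finite_image_iff strict_mono_imp_inj_on inj_on_subset)
  moreover have "n ` J \<subseteq> M" using n(1) by auto
  ultimately have "splits A B S (n ` J)"
    using pers[OF S] unfolding persistently_splits_def by blast
  then obtain x where x: "x \<in> S" "infinite {m \<in> n ` J. x \<in> A m}" "infinite {m \<in> n ` J. x \<in> B m}"
    unfolding splits_def by blast
  have "{m \<in> n ` J. x \<in> C b m} \<noteq> {}"
    using x(2,3) unfolding C_def by (cases b) (auto simp del: Collect_empty_eq)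
  then obtain k where k: "k \<in> J" "x \<in> C b (n k)"
    by blast
  have "n ` J - L k \<subseteq> n ` {..k}"
  proof
    fix m assume "m \<in> n ` J - L k"
    then obtain i where "m = n i" "n i \<notin> L k" by auto
    moreover from this later have "\<not> k < i" by blast
    ultimately show "m \<in> n ` {..k}" by auto
  qed
  then have "finite (n ` J - L k)"
    using finite_subset by blast
  moreover have "splits A B (S \<inter> C b (n k)) (n ` J)"
    unfolding splits_def using x k(2) by auto
  ultimately have "splits A B (S \<inter> C b (n k)) (L k)"
    using splits_almost_mono by blast
  then show False using k(1) unfolding J_def by blast
qed

lemma independent_subsequence:
  assumes "infinite M" "persistently_splits A B S M"
  obtains r where "strict_mono (r :: nat \<Rightarrow> nat)"
    "\<And>N \<sigma>. \<exists>x\<in>S. \<forall>j<N. x \<in> (if \<sigma> j then A (r j) else B (r j))"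
proof -
  define G where "G \<S> L \<longleftrightarrow> finite \<S> \<and> infinite L \<and> (\<forall>S\<in>\<S>. persistently_splits A B S L)" for \<S> L
  define R where "R L n L' \<longleftrightarrow> n \<in> L \<and> L' \<subseteq> L \<inter> {n<..}" for L and n :: nat and L'
  have step: "\<exists>c \<T> t. G \<T> t \<and> R s c t \<and>
      (\<forall>S\<in>\<S>. (\<exists>T\<in>\<T>. T \<subseteq> S \<inter> A c) \<and> (\<exists>T\<in>\<T>. T \<subseteq> S \<inter> B c))" if G: "G \<S> s" for \<S> s
  proof -
    from G obtain n M' where n: "n \<in> s" "M' \<subseteq> s" "infinite M'"
      "\<forall>S\<in>\<S>. persistently_splits A B (S \<inter> A n) M' \<and> persistently_splits A B (S \<inter> B n) M'"
      using persistently_splits_refine[of \<S> s A B] unfolding G_def by blast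
    let ?T = "(\<lambda>S. S \<inter> A n) ` \<S> \<union> (\<lambda>S. S \<inter> B n) ` \<S>"
    have "infinite (M' - {..n})" using n(3) by simp
    then have "G ?T (M' - {..n})"
      using G n(4) unfolding G_def persistently_splits_def by (auto simp: subset_Diff_insert dest: subset_trans[OF _ Diff_subset])
    moreover have "R s n (M' - {..n})" using n by (auto simp: R_def)
    ultimately show ?thesis by (intro exI[of _ n] exI[of _ ?T] exI[of _ "M' - {..n}"]) blast
  qed
  have start: "G {S} M" "{S} \<noteq> {}" using assms by (auto simp: G_def)
  have nonempty: "S \<noteq> {}" if "G \<S> s" "S \<in> \<S>" for \<S> s S
    using that unfolding G_def persistently_splits_def splits_def by blast
  show ?thesis
  proof (rule independent_sequence[of G "{S}" M R A B, OF start nonempty step])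
    fix r s
    assume R: "\<And>j. R (s j) (r j) (s (Suc j))"
      and *: "\<And>N \<sigma>. \<exists>S\<in>{S}. \<exists>x\<in>S. \<forall>j<N. x \<in> (if \<sigma> j then A (r j) else B (r j))"
    have "r j < r (Suc j)" for j
      using R[of j] R[of "Suc j"] unfolding R_def by auto
    then show thesis
      using * by (intro that[of r]) (auto simp: strict_mono_Suc_iff)
  qed
qed

text \<open>A bounded divergent sequence has two cluster points, and two rationals between them
  separate infinitely many terms on either side. Rational thresholds matter because only countably
  many conditions can be arranged by a diagonal sequence.\<close>
lemma convergent_if_no_splitting:
  fixes X :: "nat \<Rightarrow> real"
  assumes "bounded (range X)"
    and no: "\<And>a b. a \<in> \<rat> \<Longrightarrow> b \<in> \<rat> \<Longrightarrow> a < b \<Longrightarrow> finite {n. X n \<le> a} \<or> finite {n. b \<le> X n}"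
  shows "convergent X"
proof (rule ccontr)
  assume nc: "\<not> convergent X"
  have freq: "infinite {n. Q (X n)}" if "strict_mono (s :: nat \<Rightarrow> nat)" "\<forall>\<^sub>F n in sequentially. Q ((X \<circ> s) n)" for s Q
  proof -
    from that(2) obtain n0 where "\<And>n. n \<ge> n0 \<Longrightarrow> Q (X (s n))" by (auto simp: eventually_sequentially)
    then have "s ` {n0..} \<subseteq> {n. Q (X n)}" by auto
    moreover have "infinite (s ` {n0..})"
      using that(1) by (simp add: finite_image_iff strict_mono_imp_inj_on inj_on_subset infinite_Ici)
    ultimately show ?thesis using finite_subset by blast
  qed
  obtain l r where r: "strict_mono (r :: nat \<Rightarrow> nat)" "(X \<circ> r) \<longlonglongrightarrow> l"
    using bounded_imp_convergent_subsequence[OF assms(1)] by blast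
  from nc have "\<not> X \<longlonglongrightarrow> l" by (auto simp: convergent_def)
  then obtain e where e: "e > 0" "\<not> (\<forall>\<^sub>F n in sequentially. dist (X n) l < e)"
    unfolding tendsto_iff by blast
  then have "infinite {n. \<not> dist (X n) l < e}"
    by (simp add: eventually_cofinite[symmetric] cofinite_eq_sequentially)
  then obtain s :: "nat \<Rightarrow> nat" where s: "strict_mono s" "\<And>n. e \<le> dist (X (s n)) l"
    using infinite_enumerate by (metis (mono_tags, lifting) mem_Collect_eq not_le)
  have "bounded (range (X \<circ> s))"
    using assms(1) by (rule bounded_subset) auto
  then obtain l' r' where r': "strict_mono (r' :: nat \<Rightarrow> nat)" "(X \<circ> s \<circ> r') \<longlonglongrightarrow> l'"
    using bounded_imp_convergent_subsequence by blast
  have "e \<le> dist l' l"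
    using LIMSEQ_le_const[OF tendsto_dist[OF r'(2) tendsto_const]] s(2) by auto
  then have "l \<noteq> l'" using e(1) by auto
  have sr: "strict_mono (s \<circ> r')" using s(1) r'(1) by (rule strict_mono_o)
  have lim': "(X \<circ> (s \<circ> r')) \<longlonglongrightarrow> l'" using r'(2) by (simp add: o_assoc)
  have *: False if uv: "strict_mono u" "strict_mono v" "(X \<circ> u) \<longlonglongrightarrow> p" "(X \<circ> v) \<longlonglongrightarrow> q" and "p < q"
    for p q :: real and u v :: "nat \<Rightarrow> nat"
  proof -
    obtain a where a: "a \<in> \<rat>" "p < a" "a < q" using Rats_dense_in_real[OF \<open>p < q\<close>] by blast
    obtain b where b: "b \<in> \<rat>" "a < b" "b < q" using Rats_dense_in_real[OF a(3)] by blast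
    have "infinite {n. X n < a}" and "infinite {n. b < X n}"
      using freq[OF uv(1) order_tendstoD(2)[OF uv(3) a(2)]]
        freq[OF uv(2) order_tendstoD(1)[OF uv(4) b(3)]] by auto
    then have "infinite {n. X n \<le> a}" and "infinite {n. b \<le> X n}"
      using infinite_super[of "{n. X n < a}" "{n. X n \<le> a}"]
        infinite_super[of "{n. b < X n}" "{n. b \<le> X n}"] by (simp_all add: Collect_mono_iff)
    with no[OF a(1) b(1) b(2)] show False by simp
  qed
  consider "l < l'" | "l' < l" using \<open>l \<noteq> l'\<close> by linarith
  then show False
    by cases (rule *[OF r(1) sr r(2) lim'], assumption, rule *[OF sr r(1) lim' r(2)], assumption)
qed

text \<open>If for each of the countably many pairs of rational thresholds every index set contains
  an infinite subset that does not split, a diagonal sequence splits for no pair and therefore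
  converges pointwise. Otherwise some pair persistently splits some index set, which produces
  independence.\<close>
theorem rosenthal_dichotomy:
  fixes u :: "nat \<Rightarrow> 'p \<Rightarrow> real"
  assumes bounded: "\<And>x. x \<in> S \<Longrightarrow> bounded (range (\<lambda>n. u n x))"
  shows "(\<exists>r :: nat \<Rightarrow> nat. strict_mono r \<and> (\<forall>x\<in>S. convergent (\<lambda>n. u (r n) x))) \<or>
    (\<exists>(r :: nat \<Rightarrow> nat) a b. strict_mono r \<and> a < b \<and>
       (\<forall>N \<sigma>. \<exists>x\<in>S. \<forall>j<N. if \<sigma> j then b \<le> u (r j) x else u (r j) x \<le> a))"
proof -
  define lo hi where "lo a n = {x. u n x \<le> a}" and "hi b n = {x. b \<le> u n x}" for a b :: real and n
  define bad where "bad ab M \<longleftrightarrow> fst ab < snd ab \<longrightarrow> 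
      \<not> splits (hi (of_rat (snd ab))) (lo (of_rat (fst ab))) S M" for ab :: "rat \<times> rat" and M
  show ?thesis
  proof (cases "\<forall>ab. \<forall>M. infinite M \<longrightarrow> (\<exists>L\<subseteq>M. infinite L \<and> bad ab L)")
    case True
    define P where "P n s = bad (from_nat n) (range s)" for n and s :: "nat \<Rightarrow> nat"
    interpret subseqs P
    proof
      fix n and s :: "nat \<Rightarrow> nat" assume s: "strict_mono s"
      then have "infinite (range s)"
        by (simp add: range_inj_infinite strict_mono_imp_inj_on)
      with True obtain L where L: "L \<subseteq> range s" "infinite L" "bad (from_nat n) L" by meson
      have "infinite (s -` L)"
        using L(1,2) by (metis finite_imageI image_vimage_eq inf.orderE)
      then obtain r' :: "nat \<Rightarrow> nat" where r': "strict_mono r'" "\<And>n. r' n \<in> s -` L"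
        using infinite_enumerate by blast
      then have "range (s \<circ> r') \<subseteq> L" by auto
      with L(3) have "P n (s \<circ> r')"
        unfolding P_def bad_def splits_def
        by (smt (verit) Collect_mono_iff finite_subset subset_iff)
      with r'(1) show "\<exists>r'. strict_mono r' \<and> P n (s \<circ> r')" by blast
    qed
    have *: "P k (diagseq \<circ> ((+) (Suc k)))" for k
    proof (rule diagseq_holds)
      fix r s :: "nat \<Rightarrow> nat" and n assume "strict_mono r" "P n s"
      then show "P n (s \<circ> r)"
        unfolding P_def bad_def splits_def
        by (smt (verit) Collect_mono_iff finite_subset subset_iff image_subset_iff rangeI comp_apply rangeE)
    qed
    have bad: "bad ab (range diagseq)" for ab
    proof -
      obtain k where k: "ab = from_nat k" by (metis from_nat_to_nat)
      have "range diagseq - range (diagseq \<circ> ((+) (Suc k))) \<subseteq> diagseq ` {..k}"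
      proof
        fix m assume "m \<in> range diagseq - range (diagseq \<circ> ((+) (Suc k)))"
        then obtain i where "m = diagseq i" "\<And>j. m \<noteq> diagseq (Suc k + j)" by auto
        then show "m \<in> diagseq ` {..k}"
          by (metis atMost_iff imageI le_Suc_ex not_less_eq_eq)
      qed
      then have "finite (range diagseq - range (diagseq \<circ> ((+) (Suc k))))"
        using finite_subset by blast
      then show ?thesis
        using *[of k] splits_almost_mono unfolding P_def bad_def k by blast
    qed
    have "convergent (\<lambda>n. u (diagseq n) x)" if x: "x \<in> S" for x
    proof (rule convergent_if_no_splitting)
      show "bounded (range (\<lambda>n. u (diagseq n) x))"
        using bounded[OF x] by (rule bounded_subset) auto
      fix a b :: real assume "a \<in> \<rat>" "b \<in> \<rat>" "a < b"
      then obtain p q where pq: "a = of_rat p" "b = of_rat q" "p < q"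
        by (metis Rats_cases of_rat_less)
      have "\<not> splits (hi b) (lo a) S (range diagseq)"
        using bad[of "(p, q)"] pq by (simp add: bad_def)
      then have "finite {n \<in> range diagseq. b \<le> u n x} \<or> finite {n \<in> range diagseq. u n x \<le> a}"
        using x by (auto simp: splits_def lo_def hi_def)
      moreover have "finite {n. Q (diagseq n)}" if "finite {n \<in> range diagseq. Q n}" for Q
      proof -
        have "inj diagseq" using subseq_diagseq by (rule strict_mono_imp_inj_on)
        then have "finite (diagseq -` {n \<in> range diagseq. Q n})"
          using finite_vimageI that by blast
        then show ?thesis by (simp add: vimage_def)
      qed
      ultimately show "finite {n. u (diagseq n) x \<le> a} \<or> finite {n. b \<le> u (diagseq n) x}"
        by (meson finite_subset)
    qed
    then show ?thesis using subseq_diagseq by blast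
  next
    case False
    then obtain ab :: "rat \<times> rat" and M where M: "infinite M" "\<And>L. L \<subseteq> M \<Longrightarrow> infinite L \<Longrightarrow> \<not> bad ab L"
      by meson
    let ?a = "of_rat (fst ab) :: real" and ?b = "of_rat (snd ab) :: real"
    have less: "?a < ?b" using M(2)[OF subset_refl M(1)] by (simp add: bad_def of_rat_less)
    have "persistently_splits (hi ?b) (lo ?a) S M"
      using M(2) by (auto simp: persistently_splits_def bad_def)
    then obtain r :: "nat \<Rightarrow> nat" where r: "strict_mono r"
      "\<And>N \<sigma>. \<exists>x\<in>S. \<forall>j<N. x \<in> (if \<sigma> j then hi ?b (r j) else lo ?a (r j))"
      using independent_subsequence[OF M(1)] by blast
    have "\<exists>x\<in>S. \<forall>j<N. if \<sigma> j then ?b \<le> u (r j) x else u (r j) x \<le> ?a" for N \<sigma>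
    proof -
      obtain x where "x \<in> S" "\<forall>j<N. x \<in> (if \<sigma> j then hi ?b (r j) else lo ?a (r j))"
        using r(2) by blast
      then show ?thesis
        by (intro bexI[of _ x]) (auto simp: lo_def hi_def split: if_splits)
    qed
    then show ?thesis
      using r(1) less by (intro disjI2 exI[of _ r] exI[of _ ?a] exI[of _ ?b]) simp
  qed
qed

section \<open>Blocks that are normalised in \<open>\<ell>\<^sub>1\<close>\<close>

text \<open>The coefficients may vanish, so that an interval can be enlarged freely
  (\<open>interval_combs_mono\<close>) and supports may have gaps.\<close>
definition interval_combs :: "(nat \<Rightarrow> 'v::real_vector) \<Rightarrow> nat \<Rightarrow> nat \<Rightarrow> real \<Rightarrow> 'v set" where
  "interval_combs y l u r =
     {v. \<exists>a. (\<Sum>i\<in>{l..<u}. \<bar>a i\<bar>) = r \<and> v = (\<Sum>i\<in>{l..<u}. a i *\<^sub>R y i)}"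

lemma interval_combs_mono:
  assumes "l' \<le> l" "u \<le> u'"
  shows "interval_combs y l u r \<subseteq> interval_combs y l' u' r"
proof
  fix v assume "v \<in> interval_combs y l u r"
  then obtain a where a: "(\<Sum>i\<in>{l..<u}. \<bar>a i\<bar>) = r" "v = (\<Sum>i\<in>{l..<u}. a i *\<^sub>R y i)"
    unfolding interval_combs_def by blast
  define a' where "a' i = (if i \<in> {l..<u} then a i else 0)" for i
  have sub: "{l..<u} \<subseteq> {l'..<u'}" using assms by auto
  have "(\<Sum>i\<in>{l'..<u'}. \<bar>a' i\<bar>) = (\<Sum>i\<in>{l..<u}. \<bar>a i\<bar>)"
    by (rule sum.mono_neutral_cong_right[OF _ sub]) (auto simp: a'_def)
  moreover have "(\<Sum>i\<in>{l'..<u'}. a' i *\<^sub>R y i) = (\<Sum>i\<in>{l..<u}. a i *\<^sub>R y i)"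
    by (rule sum.mono_neutral_cong_right[OF _ sub]) (auto simp: a'_def)
  ultimately show "v \<in> interval_combs y l' u' r"
    using a unfolding interval_combs_def by auto
qed

lemma scaleR_interval_combs:
  assumes "v \<in> interval_combs y l u r"
  shows "c *\<^sub>R v \<in> interval_combs y l u (\<bar>c\<bar> * r)"
proof -
  obtain a where a: "(\<Sum>i\<in>{l..<u}. \<bar>a i\<bar>) = r" "v = (\<Sum>i\<in>{l..<u}. a i *\<^sub>R y i)"
    using assms unfolding interval_combs_def by blast
  then show ?thesis
    unfolding interval_combs_def
    by (intro CollectI exI[of _ "\<lambda>i. c * a i"])
      (auto simp: abs_mult sum_distrib_left scaleR_sum_right)
qed

lemma add_interval_combs:
  assumes v: "v \<in> interval_combs y l m r" and w: "w \<in> interval_combs y m u s" and "l \<le> m" "m \<le> u"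
  shows "v + w \<in> interval_combs y l u (r + s)"
proof -
  obtain a b where a: "(\<Sum>i\<in>{l..<m}. \<bar>a i\<bar>) = r" "v = (\<Sum>i\<in>{l..<m}. a i *\<^sub>R y i)"
    and b: "(\<Sum>i\<in>{m..<u}. \<bar>b i\<bar>) = s" "w = (\<Sum>i\<in>{m..<u}. b i *\<^sub>R y i)"
    using v w unfolding interval_combs_def by blast
  define c where "c i = (if i < m then a i else b i)" for i
  have split: "(\<Sum>i\<in>{l..<u}. f i) = (\<Sum>i\<in>{l..<m}. f i) + (\<Sum>i\<in>{m..<u}. f i)" for f :: "nat \<Rightarrow> 'z::comm_monoid_add"
    using assms(3,4) by (simp add: sum.atLeastLessThan_concat)
  have "(\<Sum>i\<in>{l..<u}. \<bar>c i\<bar>) = r + s"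
    unfolding split a(1)[symmetric] b(1)[symmetric] by (auto simp: c_def intro!: arg_cong2[of _ _ _ _ "(+)"] sum.cong)
  moreover have "(\<Sum>i\<in>{l..<u}. c i *\<^sub>R y i) = v + w"
    unfolding split a(2) b(2) by (auto simp: c_def intro!: arg_cong2[of _ _ _ _ "(+)"] sum.cong)
  ultimately show ?thesis
    unfolding interval_combs_def by auto
qed

text \<open>Blocks occupy consecutive intervals. Disjoint supports are what makes the norm of the
  coefficients multiplicative when blocks of blocks are formed (\<open>l1_block_trans\<close>), and
  thereby preserves lower \<open>\<ell>\<^sub>1\<close>-estimates.\<close>
definition l1_block :: "(nat \<Rightarrow> 'v::real_vector) \<Rightarrow> (nat \<Rightarrow> 'v) \<Rightarrow> bool" where
  "l1_block z y \<longleftrightarrow> (\<exists>p. strict_mono p \<and> (\<forall>n. z n \<in> interval_combs y (p n) (p (Suc n)) 1))"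

lemma interval_combs_trans:
  assumes "strict_mono p" and z: "\<And>n. z n \<in> interval_combs y (p n) (p (Suc n)) 1"
    and "w \<in> interval_combs z l u r" "l \<le> u"
  shows "w \<in> interval_combs y (p l) (p u) r"
proof -
  obtain b where b: "(\<Sum>k\<in>{l..<u}. \<bar>b k\<bar>) = r" "w = (\<Sum>k\<in>{l..<u}. b k *\<^sub>R z k)"
    using assms(3) unfolding interval_combs_def by blast
  have "(\<Sum>k\<in>{l..<m}. b k *\<^sub>R z k) \<in> interval_combs y (p l) (p m) (\<Sum>k\<in>{l..<m}. \<bar>b k\<bar>)"
    if "l \<le> m" for m
    using that
  proof (induction m rule: dec_induct)
    case base
    then show ?case by (simp add: interval_combs_def)
  next
    case (step m)
    have "b m *\<^sub>R z m \<in> interval_combs y (p m) (p (Suc m)) \<bar>b m\<bar>"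
      using scaleR_interval_combs[OF z[of m], of "b m"] by simp
    from add_interval_combs[OF step.IH this] step.hyps show ?case
      using strict_mono_less_eq[OF assms(1)] by simp
  qed
  from this[OF assms(4)] show ?thesis by (simp add: b)
qed

lemma l1_block_trans:
  assumes "l1_block w z" "l1_block z y"
  shows "l1_block w y"
proof -
  obtain q where q: "strict_mono q" "\<And>n. w n \<in> interval_combs z (q n) (q (Suc n)) 1"
    using assms(1) unfolding l1_block_def by blast
  obtain p where p: "strict_mono p" "\<And>n. z n \<in> interval_combs y (p n) (p (Suc n)) 1"
    using assms(2) unfolding l1_block_def by blast
  have "w n \<in> interval_combs y (p (q n)) (p (q (Suc n))) 1" for n
    by (rule interval_combs_trans[OF p q(2)]) (use strict_mono_less_eq[OF q(1)] in auto)
  moreover have "strict_mono (p \<circ> q)" using p(1) q(1) by (rule strict_mono_o)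
  ultimately show ?thesis
    unfolding l1_block_def by (intro exI[of _ "p \<circ> q"]) simp
qed

lemma nth_in_interval_combs: "y l \<in> interval_combs y l (Suc l) 1"
  unfolding interval_combs_def by (intro CollectI exI[of _ "\<lambda>_. 1"]) simp

lemma l1_block_subseq:
  assumes "strict_mono r"
  shows "l1_block (\<lambda>n. y (r n)) y"
proof -
  have "y (r n) \<in> interval_combs y (r n) (r (Suc n)) 1" for n
    using interval_combs_mono[of "r n" "r n" "Suc (r n)" "r (Suc n)" y 1] nth_in_interval_combs[of y "r n"]
      strict_monoD[OF assms, of n "Suc n"] by auto
  with assms show ?thesis unfolding l1_block_def by blast
qed

lemma interval_combs_shift:
  assumes "m \<le> l" "m \<le> u"
  shows "interval_combs (\<lambda>i. y (i + m)) (l - m) (u - m) r = interval_combs y l u r"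
proof -
  have sum: "(\<Sum>i\<in>{l..<u}. f i) = (\<Sum>i\<in>{l-m..<u-m}. f (i + m))" for f :: "nat \<Rightarrow> 'z::comm_monoid_add"
    using sum.shift_bounds_nat_ivl[of f "l - m" m "u - m"] assms by simp
  show ?thesis
  proof (intro equalityI subsetI)
    fix v assume "v \<in> interval_combs y l u r"
    then obtain a where "(\<Sum>i\<in>{l..<u}. \<bar>a i\<bar>) = r" "v = (\<Sum>i\<in>{l..<u}. a i *\<^sub>R y i)"
      unfolding interval_combs_def by blast
    then show "v \<in> interval_combs (\<lambda>i. y (i + m)) (l - m) (u - m) r"
      unfolding interval_combs_def sum by (intro CollectI exI[of _ "\<lambda>i. a (i + m)"]) simp
  next
    fix v assume "v \<in> interval_combs (\<lambda>i. y (i + m)) (l - m) (u - m) r"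
    then obtain a where "(\<Sum>i\<in>{l-m..<u-m}. \<bar>a i\<bar>) = r" "v = (\<Sum>i\<in>{l-m..<u-m}. a i *\<^sub>R y (i + m))"
      unfolding interval_combs_def by blast
    then show "v \<in> interval_combs y l u r"
      unfolding interval_combs_def sum by (intro CollectI exI[of _ "\<lambda>i. a (i - m)"]) simp
  qed
qed

lemma l1_block_shift:
  assumes "l1_block z y"
  shows "l1_block (\<lambda>n. z (n + m)) (\<lambda>n. y (n + m))"
proof -
  obtain p where p: "strict_mono p" "\<And>n. z n \<in> interval_combs y (p n) (p (Suc n)) 1"
    using assms unfolding l1_block_def by blast
  have le: "m \<le> p (n + m)" for n
    using seq_suble[OF p(1), of "n + m"] by simp
  have "z (n + m) \<in> interval_combs (\<lambda>n. y (n + m)) (p (n + m) - m) (p (Suc n + m) - m) 1" for n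
    using p(2)[of "n + m"] interval_combs_shift[OF le[of n] le[of "Suc n"], of y 1] by simp
  moreover have "strict_mono (\<lambda>n. p (n + m) - m)"
    unfolding strict_mono_Suc_iff using p(1) le by (auto simp: strict_mono_Suc_iff diff_less_mono)
  ultimately show ?thesis
    unfolding l1_block_def by (intro exI[of _ "\<lambda>n. p (n + m) - m"]) simp
qed

text \<open>The term with number \<open>m + n\<close> of the diagonal is a combination of terms of
  \<open>z m\<close> with indices from \<open>P n (m + n)\<close> on. As a strictly increasing index
  map never falls below the identity, the support of each diagonal term ends before that of the next
  one begins, so the tail of the diagonal is again a sequence of successive blocks of \<open>z
  m\<close>.\<close>
lemma l1_block_diagonal:
  assumes "\<And>m. l1_block (z (Suc m)) (z m)"
  shows "l1_block (\<lambda>n. z (n + m) (n + m)) (z m)"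
proof -
  obtain p where p: "\<And>m. strict_mono (p m)"
      "\<And>m n. z (Suc m) n \<in> interval_combs (z m) (p m n) (p m (Suc n)) 1"
    using assms unfolding l1_block_def by metis
  define P where "P = rec_nat id (\<lambda>n q. q \<circ> p (m + n))"
  have P0: "P 0 = id" and PS: "P (Suc n) = P n \<circ> p (m + n)" for n
    by (simp_all add: P_def)
  have mono: "strict_mono (P n)" for n
  proof (induction n)
    case 0
    show ?case by (simp only: P0 strict_mono_id)
  next
    case (Suc n)
    show ?case unfolding PS by (rule strict_mono_o[OF Suc p(1)])
  qed
  have comb: "z (m + n) j \<in> interval_combs (z m) (P n j) (P n (Suc j)) 1" for n j
  proof (induction n arbitrary: j)
    case 0
    then show ?case using nth_in_interval_combs by (simp add: P0)
  next
    case (Suc n)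
    have "p (m + n) j \<le> p (m + n) (Suc j)"
      using strict_mono_less_eq[OF p(1)] by simp
    then show ?case
      using interval_combs_trans[OF mono[of n] Suc.IH, of "z (Suc (m + n)) j"] p(2)[of "m + n" j]
      by (simp add: PS)
  qed
  define q where "q n = P n (m + n)" for n
  have step: "P n (Suc (m + n)) \<le> q (Suc n)" for n
    using seq_suble[OF p(1)[of "m + n"], of "Suc (m + n)"] strict_mono_less_eq[OF mono[of n]]
    by (simp add: q_def PS)
  have "strict_mono q"
    unfolding strict_mono_Suc_iff
  proof
    fix n
    have "q n < P n (Suc (m + n))" using strict_monoD[OF mono[of n]] by (simp add: q_def)
    with step[of n] show "q n < q (Suc n)" by simp
  qed
  moreover have "z (n + m) (n + m) \<in> interval_combs (z m) (q n) (q (Suc n)) 1" for n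
    using comb[of n "m + n"] interval_combs_mono[OF order_refl step[of n], of "z m" "q n" 1]
    by (auto simp: q_def add.commute)
  ultimately show ?thesis
    unfolding l1_block_def by blast
qed

text \<open>Countably many properties that pass to blocks and depend only on tails can be decided
  simultaneously: at stage \<open>m\<close> pass to a block with property \<open>m\<close> whenever
  there is one, and take the diagonal. No block of the diagonal then has any of the properties
  unless the diagonal has it already.\<close>
lemma l1_block_stabilise:
  fixes P :: "nat \<Rightarrow> (nat \<Rightarrow> 'v::real_vector) \<Rightarrow> bool"
  assumes hered: "\<And>i z w. P i z \<Longrightarrow> l1_block w z \<Longrightarrow> P i w"
    and tail: "\<And>i z m. P i (\<lambda>n. z (n + m)) \<Longrightarrow> P i z"
  shows "\<exists>d. l1_block d y \<and> (\<forall>i w. l1_block w d \<longrightarrow> P i w \<longrightarrow> P i d)"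
proof -
  have refl: "l1_block z z" for z :: "nat \<Rightarrow> 'v"
    using l1_block_subseq[of id z] by (simp add: strict_mono_id)
  have "\<exists>z. z 0 = y \<and> (\<forall>m. l1_block (z (Suc m)) (z m) \<and> ((\<exists>w. l1_block w (z m) \<and> P m w) \<longrightarrow> P m (z (Suc m))))"
  proof -
    have "\<exists>z. \<forall>m. (m = 0 \<longrightarrow> z m = y) \<and> (l1_block (z (Suc m)) (z m) \<and>
        ((\<exists>w. l1_block w (z m) \<and> P m w) \<longrightarrow> P m (z (Suc m))))"
    proof (rule dependent_nat_choice)
      show "\<exists>y'. (Suc n = 0 \<longrightarrow> y' = y) \<and> l1_block y' x \<and> ((\<exists>w. l1_block w x \<and> P n w) \<longrightarrow> P n y')" for x n
        using refl by (cases "\<exists>w. l1_block w x \<and> P n w") auto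
    qed simp
    then show ?thesis by blast
  qed
  then obtain z where z: "z 0 = y" "\<And>m. l1_block (z (Suc m)) (z m)"
      "\<And>m w. l1_block w (z m) \<Longrightarrow> P m w \<Longrightarrow> P m (z (Suc m))"
    by blast
  define d where "d n = z n n" for n
  have d: "l1_block (\<lambda>n. d (n + m)) (z m)" for m
    unfolding d_def by (rule l1_block_diagonal[of z, OF z(2)])
  show ?thesis
  proof (intro exI[of _ d] conjI allI impI)
    show "l1_block d y" using d[of 0] z(1) by simp
    fix i w assume w: "l1_block w d" "P i w"
    have "l1_block (\<lambda>n. w (n + i)) (z i)"
      using l1_block_trans[OF l1_block_shift[OF w(1)] d] .
    moreover have "P i (\<lambda>n. w (n + i))"
      using hered[OF w(2)] l1_block_subseq[of "\<lambda>n. n + i" w] by (simp add: strict_mono_def)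
    ultimately have "P i (z (Suc i))" by (rule z(3))
    then have "P i (\<lambda>n. d (n + Suc i))" by (rule hered[OF _ d])
    then show "P i d" by (rule tail)
  qed
qed

section \<open>Norm estimates for blocks of functionals\<close>
lemma norm_interval_combs_le:
  fixes y :: "nat \<Rightarrow> 'v::real_normed_vector"
  assumes v: "v \<in> interval_combs y l u r" and t: "\<And>i. l \<le> i \<Longrightarrow> norm (y i) \<le> t"
  shows "norm v \<le> r * t"
proof -
  obtain a where a: "(\<Sum>i\<in>{l..<u}. \<bar>a i\<bar>) = r" "v = (\<Sum>i\<in>{l..<u}. a i *\<^sub>R y i)"
    using v unfolding interval_combs_def by blast
  have "norm v \<le> (\<Sum>i\<in>{l..<u}. \<bar>a i\<bar> * t)"
    unfolding a(2) by (rule sum_norm_le) (auto intro!: mult_left_mono t)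
  then show ?thesis by (simp add: a(1) sum_distrib_right[symmetric])
qed

lemma interval_combs_apply:
  assumes "v \<in> interval_combs y l u r"
  shows "blinfun_apply v x \<in> interval_combs (\<lambda>i. blinfun_apply (y i) x) l u r"
  using assms unfolding interval_combs_def
  by (auto simp: blinfun.sum_left blinfun.scaleR_left)

lemma l1_block_apply_le:
  fixes z :: "nat \<Rightarrow> 'a::real_normed_vector \<Rightarrow>\<^sub>L 'b::real_normed_vector"
  assumes "l1_block w z" "\<forall>\<^sub>F n in sequentially. norm (z n x) \<le> t"
  shows "\<forall>\<^sub>F n in sequentially. norm (w n x) \<le> t"
proof -
  obtain p where p: "strict_mono p" "\<And>n. w n \<in> interval_combs z (p n) (p (Suc n)) 1"
    using assms(1) unfolding l1_block_def by blast
  obtain N where N: "\<And>n. n \<ge> N \<Longrightarrow> norm (z n x) \<le> t"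
    using assms(2) by (auto simp: eventually_sequentially)
  have "norm (w n x) \<le> t" if "n \<ge> N" for n
  proof -
    have "norm (z i x) \<le> t" if "p n \<le> i" for i
      using N seq_suble[OF p(1), of n] \<open>n \<ge> N\<close> that by simp
    from norm_interval_combs_le[OF interval_combs_apply[OF p(2), of n x] this]
    show ?thesis by simp
  qed
  then show ?thesis by (auto simp: eventually_sequentially)
qed

lemma l1_block_norm_le:
  fixes z :: "nat \<Rightarrow> 'v::real_normed_vector"
  assumes "l1_block w z" "\<And>n. norm (z n) \<le> t"
  shows "norm (w n) \<le> t"
  using assms norm_interval_combs_le[of "w n" z _ _ 1 t] unfolding l1_block_def by auto

lemma l1_block_norm_ge:
  fixes z :: "nat \<Rightarrow> 'v::real_normed_vector"
  assumes "l1_block w z" and lower: "\<And>a N. c * (\<Sum>i<N. \<bar>a i\<bar>) \<le> norm (\<Sum>i<N. a i *\<^sub>R z i)"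
  shows "c \<le> norm (w n)"
proof -
  obtain l u where "w n \<in> interval_combs z l u 1"
    using assms(1) unfolding l1_block_def by blast
  then have "w n \<in> interval_combs z 0 u 1"
    using interval_combs_mono[of 0 l u u z 1] by auto
  then obtain a where "(\<Sum>i<u. \<bar>a i\<bar>) = 1" "w n = (\<Sum>i<u. a i *\<^sub>R z i)"
    unfolding interval_combs_def atLeast0LessThan by blast
  with lower[of a u] show ?thesis by simp
qed

lemma l1_block_in_subspace:
  assumes "l1_block w z" "subspace V" "\<And>n. z n \<in> V"
  shows "w n \<in> V"
proof -
  obtain l u where "w n \<in> interval_combs z l u 1"
    using assms(1) unfolding l1_block_def by blast
  then show ?thesis
    using assms(2,3) unfolding interval_combs_def by (auto intro!: subspace_sum subspace_scale)
qed

lemma dual_scale_of_real: "dual_scale (of_real r) f = r *\<^sub>R f"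
  by (rule blinfun_eqI) (simp add: blinfun.scaleR_left scaleR_conv_of_real)

interpretation dual: vector_space dual_scale
  by (rule vector_space_dual_scale)

lemma real_subspace_if_dual_subspace:
  assumes "dual.subspace V"
  shows "subspace V"
  using dual.subspace_0[OF assms] dual.subspace_add[OF assms] dual.subspace_scale[OF assms, of _ "of_real _"]
  by (intro subspaceI) (auto simp: dual_scale_of_real)

lemma dual_subspace_dual_space: "dual.subspace (dual_space scl)"
  by (rule dual.subspaceI) (auto simp: dual_space_def blinfun.add_left algebra_simps)

lemma norm_attained_half:
  fixes f :: "'a::real_normed_vector \<Rightarrow>\<^sub>L 'b::real_normed_vector"
  assumes "norm f = 1"
  obtains x where "norm x \<le> 1" "1 / 2 \<le> norm (f x)"
proof (rule ccontr)
  assume "\<not> thesis"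
  then have small: "norm (f x) \<le> 1 / 2" if "norm x \<le> 1" for x
    using that \<open>\<And>x. norm x \<le> 1 \<Longrightarrow> 1 / 2 \<le> norm (f x) \<Longrightarrow> thesis\<close> by fastforce
  have "norm f \<le> 1 / 2"
  proof (rule norm_blinfun_bound)
    fix x
    show "norm (f x) \<le> 1 / 2 * norm x"
    proof (cases "x = 0")
      case False
      then have "norm (f ((1 / norm x) *\<^sub>R x)) \<le> 1 / 2" by (intro small) simp
      with False show ?thesis by (simp add: blinfun.scaleR_right field_simps)
    qed simp
  qed simp
  with assms show False by simp
qed

section \<open>Separated functionals and independence\<close>

text \<open>The functionals in \<open>F\<close> that vanish on a finite set have finite codimension
  in \<open>F\<close>.\<close>
lemma exists_vanishing_functional:
  assumes F: "dual.subspace F" "infinite_dimensional dual_scale F" and "finite X"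
  obtains f where "f \<in> F" "norm f = 1" "\<And>x. x \<in> X \<Longrightarrow> blinfun_apply f x = 0"
proof -
  have "\<exists>S. finite S \<and> (\<forall>f\<in>F. \<exists>s\<in>dual.span S. f - s \<in> F \<and> (\<forall>x\<in>X. blinfun_apply (f - s) x = 0))"
    using \<open>finite X\<close>
  proof (induction X rule: finite_induct)
    case empty
    show ?case by (rule exI[of _ "{}"]) (auto intro!: bexI[of _ 0])
  next
    case (insert x X)
    then obtain S where S: "finite S"
      "\<And>f. f \<in> F \<Longrightarrow> \<exists>s\<in>dual.span S. f - s \<in> F \<and> (\<forall>x\<in>X. blinfun_apply (f - s) x = 0)"
      by blast
    show ?case
    proof (cases "\<exists>g\<in>F. (\<forall>x\<in>X. blinfun_apply g x = 0) \<and> blinfun_apply g x \<noteq> 0")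
      case False
      then show ?thesis using S by (intro exI[of _ S]) (metis insert_iff)
    next
      case True
      then obtain g where g: "g \<in> F" "\<And>x. x \<in> X \<Longrightarrow> blinfun_apply g x = 0" "blinfun_apply g x \<noteq> 0"
        by blast
      have "\<exists>s\<in>dual.span (insert g S). f - s \<in> F \<and> (\<forall>x\<in>insert x X. blinfun_apply (f - s) x = 0)"
        if f: "f \<in> F" for f
      proof -
        obtain s where s: "s \<in> dual.span S" "f - s \<in> F" "\<And>x. x \<in> X \<Longrightarrow> blinfun_apply (f - s) x = 0"
          using S(2)[OF f] by blast
        let ?c = "blinfun_apply (f - s) x / blinfun_apply g x"
        have "s + dual_scale ?c g \<in> dual.span (insert g S)"
          using s(1) by (intro dual.span_add dual.span_scale)
            (auto intro: dual.span_base dual.span_mono[THEN subsetD, rotated])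
        moreover have eq: "f - (s + dual_scale ?c g) = (f - s) - dual_scale ?c g" by simp
        moreover have "(f - s) - dual_scale ?c g \<in> F"
          by (rule dual.subspace_diff[OF F(1) s(2) dual.subspace_scale[OF F(1) g(1)]])
        moreover have "blinfun_apply ((f - s) - dual_scale ?c g) y = 0" if "y \<in> insert x X" for y
          using that s(3) g(2,3) by (auto simp: blinfun.diff_left)
        ultimately show ?thesis
          by (intro bexI[of _ "s + dual_scale ?c g"] conjI ballI) (simp_all only: eq)
      qed
      then show ?thesis using S(1) by (intro exI[of _ "insert g S"]) simp
    qed
  qed
  then obtain S where S: "finite S"
      "\<And>f. f \<in> F \<Longrightarrow> \<exists>s\<in>dual.span S. f - s \<in> F \<and> (\<forall>x\<in>X. blinfun_apply (f - s) x = 0)"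
    by blast
  obtain f where f: "f \<in> F" "f \<notin> dual.span S"
    using F(2) S(1) unfolding infinite_dimensional_def by blast
  then obtain s where s: "s \<in> dual.span S" "f - s \<in> F" "\<And>x. x \<in> X \<Longrightarrow> blinfun_apply (f - s) x = 0"
    using S(2) by blast
  have "f - s \<noteq> 0" using f(2) s(1) by auto
  show thesis
  proof (rule that)
    let ?g = "(1 / norm (f - s)) *\<^sub>R (f - s)"
    show "?g \<in> F"
      using real_subspace_if_dual_subspace[OF F(1)] s(2) by (rule subspace_scale)
    show "norm ?g = 1" using \<open>f - s \<noteq> 0\<close> by simp
    show "blinfun_apply ?g x = 0" if "x \<in> X" for x
      using s(3)[OF that] by (simp add: blinfun.scaleR_left)
  qed
qed

text \<open>Riesz's lemma would give separated unit vectors in any infinite dimensional normed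
  space. For functionals there is a more elementary way: let each \<open>f n\<close> vanish at the
  points where the earlier functionals are large; these points then witness the separation.\<close>
lemma separated_unit_functionals:
  assumes F: "dual.subspace F" "infinite_dimensional dual_scale F"
  obtains f :: "nat \<Rightarrow> 'e::banach \<Rightarrow>\<^sub>L 'k::real_or_complex"
  where "\<And>n. f n \<in> F" "\<And>n. norm (f n) = 1" "\<And>m n. m \<noteq> n \<Longrightarrow> 1 / 2 \<le> norm (f m - f n)"
proof -
  define P where "P y \<longleftrightarrow> (case y of (f, x, X) \<Rightarrow> f \<in> F \<and> norm f = 1 \<and> norm x \<le> 1 \<and>
      1 / 2 \<le> norm (blinfun_apply f x) \<and> x \<in> X \<and> finite X)" for y :: "('e \<Rightarrow>\<^sub>L 'k) \<times> 'e \<times> 'e set"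
  have new: "\<exists>f x. P (f, x, insert x X) \<and> (\<forall>z\<in>X. blinfun_apply f z = 0)" if "finite X" for X
  proof -
    obtain f where f: "f \<in> F" "norm f = 1" "\<And>x. x \<in> X \<Longrightarrow> blinfun_apply f x = 0"
      using exists_vanishing_functional[OF F \<open>finite X\<close>] by blast
    obtain x where "norm x \<le> 1" "1 / 2 \<le> norm (blinfun_apply f x)"
      using norm_attained_half[OF f(2)] by blast
    with f that show ?thesis by (intro exI[of _ f] exI[of _ x]) (simp add: P_def)
  qed
  have "\<exists>g. \<forall>n::nat. P (g n) \<and> ((\<forall>z\<in>snd (snd (g n)). blinfun_apply (fst (g (Suc n))) z = 0) \<and>
      snd (snd (g n)) \<subseteq> snd (snd (g (Suc n))))"
  proof (rule dependent_nat_choice)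
    show "\<exists>y. P y" using new[of "{}"] by auto
    fix y assume "P y"
    then have "finite (snd (snd y))" by (auto simp: P_def split: prod.splits)
    from new[OF this] obtain f x where "P (f, x, insert x (snd (snd y)))"
        "\<forall>z\<in>snd (snd y). blinfun_apply f z = 0"
      by blast
    then show "\<exists>y'. P y' \<and> ((\<forall>z\<in>snd (snd y). blinfun_apply (fst y') z = 0) \<and>
        snd (snd y) \<subseteq> snd (snd y'))"
      by (intro exI[of _ "(f, x, insert x (snd (snd y)))"]) auto
  qed
  then obtain g where g: "\<And>n. P (g n)" "\<And>n z. z \<in> snd (snd (g n)) \<Longrightarrow> blinfun_apply (fst (g (Suc n))) z = 0"
      "\<And>n. snd (snd (g n)) \<subseteq> snd (snd (g (Suc n)))"
    by blast
  define f x X where "f n = fst (g n)" and "x n = fst (snd (g n))" and "X n = snd (snd (g n))" for n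
  have f: "f n \<in> F" "norm (f n) = 1" "norm (x n) \<le> 1" "1 / 2 \<le> norm (blinfun_apply (f n) (x n))" "x n \<in> X n" for n
    using g(1)[of n] by (auto simp: P_def f_def x_def X_def split: prod.splits)
  have X: "X m \<subseteq> X n" if "m \<le> n" for m n
    using that by (rule lift_Suc_mono_le[of X, rotated]) (simp add: X_def g(3))
  have zero: "blinfun_apply (f n) (x m) = 0" if "m < n" for m n
  proof -
    have "m \<le> n - 1" using that by simp
    then have "x m \<in> X (n - 1)" using f(5)[of m] X[of m "n - 1"] by blast
    then show ?thesis
      using g(2)[of "x m" "n - 1"] that by (simp add: X_def f_def)
  qed
  have sep: "1 / 2 \<le> norm (f m - f n)" if "m < n" for m n
  proof -
    have "1 / 2 \<le> norm (blinfun_apply (f m - f n) (x m))"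
      using f(4)[of m] zero[OF that] by (simp add: blinfun.diff_left)
    also have "\<dots> \<le> norm (f m - f n) * norm (x m)" by (rule norm_blinfun)
    also have "\<dots> \<le> norm (f m - f n) * 1" by (intro mult_left_mono f(3)) simp
    finally show ?thesis by simp
  qed
  have "1 / 2 \<le> norm (f m - f n)" if "m \<noteq> n" for m n
    using sep[of m n] sep[of n m] that by (cases "m < n") (auto simp: norm_minus_commute)
  with f(1,2) show thesis by (intro that)
qed

text \<open>Evaluate the combination at the difference of two points that realise the sign pattern
  of the coefficients and the opposite pattern. Each term then contributes the gap \<open>b -
  a\<close>, wherever the two thresholds lie, and the difference has norm at most
  \<open>2\<close>.\<close>
lemma l1_lower_bound_if_independent:
  fixes y :: "nat \<Rightarrow> 'e::banach \<Rightarrow>\<^sub>L 'k::real_or_complex"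
  assumes "a < b"
    and indep: "\<And>N \<sigma>. \<exists>x. norm x \<le> 1 \<and> (\<forall>j<N. if \<sigma> j then b \<le> re_part (y j x) else re_part (y j x) \<le> a)"
  shows "(b - a) / 2 * (\<Sum>i<N. \<bar>\<alpha> i\<bar>) \<le> norm (\<Sum>i<N. \<alpha> i *\<^sub>R y i)"
proof -
  obtain x where x: "norm x \<le> 1" "\<And>j. j < N \<Longrightarrow> if 0 \<le> \<alpha> j then b \<le> re_part (y j x) else re_part (y j x) \<le> a"
    using indep[of N "\<lambda>j. 0 \<le> \<alpha> j"] by blast
  obtain x' where x': "norm x' \<le> 1" "\<And>j. j < N \<Longrightarrow> if \<not> 0 \<le> \<alpha> j then b \<le> re_part (y j x') else re_part (y j x') \<le> a"
    using indep[of N "\<lambda>j. \<not> 0 \<le> \<alpha> j"] by blast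
  let ?v = "\<Sum>i<N. \<alpha> i *\<^sub>R y i"
  have "(b - a) * (\<Sum>i<N. \<bar>\<alpha> i\<bar>) = (\<Sum>i<N. \<bar>\<alpha> i\<bar> * (b - a))"
    by (simp add: sum_distrib_left mult.commute)
  also have "\<dots> \<le> (\<Sum>i<N. \<alpha> i * (re_part (y i x) - re_part (y i x')))"
  proof (rule sum_mono)
    fix i assume "i \<in> {..<N}"
    then have i: "i < N" by simp
    show "\<bar>\<alpha> i\<bar> * (b - a) \<le> \<alpha> i * (re_part (y i x) - re_part (y i x'))"
    proof (cases "0 \<le> \<alpha> i")
      case True
      then have "b - a \<le> re_part (y i x) - re_part (y i x')"
        using x(2)[OF i] x'(2)[OF i] by auto
      then show ?thesis using True by (simp add: mult_left_mono)
    next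
      case False
      then have "b - a \<le> re_part (y i x') - re_part (y i x)"
        using x(2)[OF i] x'(2)[OF i] by auto
      then have "(- \<alpha> i) * (b - a) \<le> (- \<alpha> i) * (re_part (y i x') - re_part (y i x))"
        using False by (intro mult_left_mono) auto
      then show ?thesis using False by (simp add: algebra_simps)
    qed
  qed
  also have "\<dots> = re_part (blinfun_apply ?v (x - x'))"
    by (simp add: blinfun.sum_left blinfun.scaleR_left blinfun.diff_right linear_sum[OF linear_re_part]
      linear_scale[OF linear_re_part] linear_diff[OF linear_re_part] o_def right_diff_distrib sum_subtractf)
  also have "\<dots> \<le> norm (blinfun_apply ?v (x - x'))"
    using abs_re_part_le abs_le_D1 by blast
  also have "\<dots> \<le> norm ?v * norm (x - x')" by (rule norm_blinfun)
  also have "\<dots> \<le> norm ?v * 2"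
    using norm_triangle_ineq4[of x x'] x(1) x'(1) by (intro mult_left_mono) auto
  finally show ?thesis by simp
qed

section \<open>The construction of Hagler and Johnson\<close>

text \<open>A scalar of modulus barely above \<open>\<delta>\<close> whose real part is barely below
  \<open>\<delta>\<close> is close to \<open>\<delta>\<close>: its imaginary part has no room. The
  error bounds are those of \<open>oscillating_vector\<close>, where \<open>K\<close> is the length
  of an average; the constant \<open>160\<close> makes the resulting error at most a quarter of
  \<open>\<delta>\<close>.\<close>
lemma near_signed_real:
  fixes t :: "'k::real_or_complex"
  assumes "0 < \<delta>" "1 \<le> K" and s: "s = 1 \<or> s = - 1" and \<eta>: "\<eta> = \<delta> / (160 * K)"
    and "norm t \<le> \<delta> + \<eta>" and "\<delta> - 3 * K * \<eta> \<le> s * re_part t"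
  shows "norm (t - of_real (s * \<delta>)) \<le> \<delta> / 4"
proof -
  have K\<eta>: "K * \<eta> = \<delta> / 160" using assms(2) by (simp add: \<eta>)
  have "0 < \<eta>" using assms(1,2) by (simp add: \<eta>)
  moreover have "1 * \<eta> \<le> K * \<eta>" using assms(2) calculation by (intro mult_right_mono) auto
  ultimately have \<eta>': "0 < \<eta>" "\<eta> \<le> \<delta> / 160" using K\<eta> by auto
  have "(norm t)\<^sup>2 \<le> (\<delta> + \<delta> / 160)\<^sup>2"
    using assms(5) \<eta>' by (intro power_mono) auto
  moreover have "\<delta> * (\<delta> - 3 * (\<delta> / 160)) \<le> \<delta> * (s * re_part t)"
    using assms(1,6) K\<eta> by (intro mult_left_mono) auto
  moreover have "s\<^sup>2 = 1" using s by auto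
  ultimately have "(norm (t - of_real (s * \<delta>)))\<^sup>2 \<le> (\<delta> + \<delta> / 160)\<^sup>2 - 2 * (\<delta> * (\<delta> - 3 * (\<delta> / 160))) + \<delta>\<^sup>2"
    unfolding norm_diff_of_real_power2 power_mult_distrib by (simp add: algebra_simps)
  also have "\<dots> = \<delta>\<^sup>2 * (1281 / 25600)"
    by (simp add: power2_eq_square field_simps)
  also have "\<dots> \<le> \<delta>\<^sup>2 * (1 / 16)" by (intro mult_left_mono) auto
  also have "\<dots> = (\<delta> / 4)\<^sup>2" by (simp add: power2_eq_square)
  finally show ?thesis
    using assms(1) by (simp add: power2_le_iff_abs_le)
qed

text \<open>Real signs suffice for complex coefficients, at the price of a factor \<open>2\<close>:
  choose them for the real parts or for the imaginary parts, whichever sum is larger.\<close>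
lemma sign_choice:
  fixes a :: "nat \<Rightarrow> 'k::real_or_complex"
  obtains \<sigma> :: "nat \<Rightarrow> bool"
  where "(\<Sum>j<N. norm (a j)) \<le> 2 * norm (\<Sum>j<N. of_real (if \<sigma> j then 1 else - 1) * a j)"
proof -
  obtain u :: 'k where i: "norm u = 1" "\<And>t. norm t \<le> \<bar>re_part t\<bar> + \<bar>re_part (u * t)\<bar>"
    using norm_le_re_parts by blast
  let ?sum = "\<lambda>\<sigma>. \<Sum>j<N. of_real (if \<sigma> j then 1 else - 1) * a j"
  have abs: "(\<Sum>j<N. \<bar>re_part (c * a j)\<bar>) \<le> norm (?sum (\<lambda>j. 0 \<le> re_part (c * a j)))"
    if c: "norm c = 1" for c
  proof -
    let ?s = "\<lambda>j. if 0 \<le> re_part (c * a j) then 1 else - 1 :: real"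
    have "(\<Sum>j<N. \<bar>re_part (c * a j)\<bar>) = (\<Sum>j<N. re_part (?s j *\<^sub>R (c * a j)))"
      by (intro sum.cong) (auto simp: linear_neg[OF linear_re_part])
    also have "\<dots> = re_part (\<Sum>j<N. ?s j *\<^sub>R (c * a j))"
      by (simp only: linear_sum[OF linear_re_part] o_def)
    also have "(\<Sum>j<N. ?s j *\<^sub>R (c * a j)) = c * (\<Sum>j<N. of_real (?s j) * a j)"
      by (simp add: sum_distrib_left scaleR_conv_of_real algebra_simps del: of_real_minus)
    also have "re_part (c * (\<Sum>j<N. of_real (?s j) * a j)) \<le> norm (c * (\<Sum>j<N. of_real (?s j) * a j))"
      using abs_re_part_le abs_le_D1 by blast
    finally show ?thesis by (simp only: norm_mult c mult_1)
  qed
  have "(\<Sum>j<N. norm (a j)) \<le> (\<Sum>j<N. \<bar>re_part (a j)\<bar>) + (\<Sum>j<N. \<bar>re_part (u * a j)\<bar>)"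
    unfolding sum.distrib[symmetric] by (intro sum_mono i(2))
  also have "\<dots> \<le> norm (?sum (\<lambda>j. 0 \<le> re_part (a j))) + norm (?sum (\<lambda>j. 0 \<le> re_part (u * a j)))"
    using abs[of 1] abs[OF i(1)] by simp
  finally have "(\<Sum>j<N. norm (a j)) \<le> 2 * norm (?sum (\<lambda>j. 0 \<le> re_part (a j))) \<or>
      (\<Sum>j<N. norm (a j)) \<le> 2 * norm (?sum (\<lambda>j. 0 \<le> re_part (u * a j)))"
    by linarith
  then show thesis
    using that[of "\<lambda>j. 0 \<le> re_part (a j)"] that[of "\<lambda>j. 0 \<le> re_part (u * a j)"] by (elim disjE)
qed

lemma increasing_choice:
  fixes M :: "nat \<Rightarrow> nat set"
  assumes "\<And>j. infinite (M j)"
  obtains h where "strict_mono h" "\<And>j. h j \<in> M j"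
proof -
  have "\<exists>h. \<forall>j. h j \<in> M j \<and> h j < h (Suc j)"
  proof (rule dependent_nat_choice)
    show "\<exists>k. k \<in> M 0" using assms[of 0] by (metis ex_in_conv finite.emptyI)
    show "\<exists>k'. k' \<in> M (Suc j) \<and> k < k'" for k j
      using assms[of "Suc j"] infinite_nat_iff_unbounded by blast
  qed
  then show thesis using that by (auto simp: strict_mono_Suc_iff)
qed

context banach_space_over
begin

lemma dual_apply_scl:
  assumes "f \<in> dual_space scl"
  shows "blinfun_apply f (scl c x) = c * blinfun_apply f x"
  using assms by (simp add: dual_space_def)

lemma bounded_linear_scl: "bounded_linear (scl c)"
proof (rule bounded_linear_intro)
  show "scl c (x + y) = scl c x + scl c y" for x y by (rule scale_right_distrib)
  show "scl c (r *\<^sub>R x) = r *\<^sub>R scl c x" for r x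
    by (simp add: scl_of_real[symmetric] mult.commute)
  show "norm (scl c x) \<le> norm x * norm c" for x
    by (simp add: norm_scl mult.commute)
qed

text \<open>The map \<open>a \<mapsto> \<Sum> a\<^sub>j x\<^sub>j\<close>; the lower estimate passes
  from finite sums to series by continuity of the norm.\<close>
lemma contains_copy_of_l1I:
  fixes x :: "nat \<Rightarrow> 'e"
  assumes x: "\<And>j. norm (x j) \<le> 1" and "0 < c"
    and lower: "\<And>(a :: nat \<Rightarrow> 'k) N. c * (\<Sum>j<N. norm (a j)) \<le> norm (\<Sum>j<N. scl (a j) (x j))"
  shows "contains_copy_of_l1 scl"
proof -
  define T where "T a = (\<Sum>j. scl (a j) (x j))" for a :: "nat \<Rightarrow> 'k"
  have term_le: "norm (scl (a j) (x j)) \<le> norm (a j)" for a :: "nat \<Rightarrow> 'k" and j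
    using mult_left_mono[OF x[of j], of "norm (a j)"] by (simp add: norm_scl)
  have abs_summable: "summable (\<lambda>j. norm (scl (a j) (x j)))" if "a \<in> l1" for a :: "nat \<Rightarrow> 'k"
    using that term_le unfolding l1_def by (auto intro: summable_comparison_test'[where N = 0])
  note summable = summable_norm_cancel[OF abs_summable]
  have add: "T (\<lambda>n. a n + b n) = T a + T b" if "a \<in> l1" "b \<in> l1" for a b
    unfolding T_def scale_left_distrib using suminf_add[OF summable summable] that by simp
  have scale: "T (\<lambda>n. s * a n) = scl s (T a)" if "a \<in> l1" for s a
    unfolding T_def scale_scale[symmetric]
    by (rule bounded_linear.suminf[OF bounded_linear_scl summable[OF that], symmetric])
  have l1_add: "(\<lambda>n. a n + b n) \<in> l1" if "a \<in> l1" "b \<in> l1" for a b :: "nat \<Rightarrow> 'k"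
    using that unfolding l1_def
    by (auto intro!: summable_comparison_test'[where N = 0 and g = "\<lambda>n. norm (a n) + norm (b n)"]
      summable_add norm_triangle_ineq)
  have l1_scale: "(\<lambda>n. s * a n) \<in> l1" if "a \<in> l1" for s and a :: "nat \<Rightarrow> 'k"
    using that unfolding l1_def by (auto simp: norm_mult intro: summable_mult)
  have upper: "norm (T a) \<le> 1 * l1_norm a" if "a \<in> l1" for a
  proof -
    have "norm (T a) \<le> (\<Sum>j. norm (scl (a j) (x j)))"
      unfolding T_def by (rule summable_norm[OF abs_summable[OF that]])
    also have "\<dots> \<le> l1_norm a"
      unfolding l1_norm_def using that term_le abs_summable[OF that]
      by (intro suminf_le) (auto simp: l1_def)
    finally show ?thesis by simp
  qed
  have lower': "c * l1_norm a \<le> norm (T a)" if "a \<in> l1" for a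
  proof (rule LIMSEQ_le)
    have "(\<lambda>N. \<Sum>j<N. norm (a j)) \<longlonglongrightarrow> l1_norm a"
      unfolding l1_norm_def using that by (intro summable_LIMSEQ) (simp add: l1_def)
    then show "(\<lambda>N. c * (\<Sum>j<N. norm (a j))) \<longlonglongrightarrow> c * l1_norm a"
      by (intro tendsto_mult_left)
    show "(\<lambda>N. norm (\<Sum>j<N. scl (a j) (x j))) \<longlonglongrightarrow> norm (T a)"
      unfolding T_def by (intro tendsto_norm summable_LIMSEQ summable that)
  qed (use lower in auto)
  have inj: "inj_on T l1"
  proof
    fix a b assume ab: "a \<in> l1" "b \<in> l1" "T a = T b"
    let ?d = "\<lambda>n. a n + (- 1) * b n"
    have d: "?d \<in> l1" using ab l1_add[OF _ l1_scale] by blast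
    have "T ?d = T a + T (\<lambda>n. (- 1) * b n)"
      using add[OF ab(1) l1_scale[OF ab(2)]] .
    then have "T ?d = 0"
      using scale[OF ab(2), of "- 1"] ab(3) by (simp add: scale_minus_left)
    then have "l1_norm ?d \<le> 0"
      using lower'[OF d] \<open>0 < c\<close> by (simp add: mult_le_0_iff)
    moreover have sm: "summable (\<lambda>n. norm (?d n))" using d by (simp add: l1_def)
    ultimately have "norm (?d n) = 0" for n
      using suminf_eq_zero_iff[OF sm] suminf_nonneg[OF sm] unfolding l1_norm_def by force
    then show "a = b" by auto
  qed
  have zero: "(\<lambda>_. 0) \<in> l1" by (simp add: l1_def)
  have "module.subspace scl (T ` l1)"
  proof (rule subspaceI)
    show "0 \<in> T ` l1" using zero by (intro image_eqI[of _ _ "\<lambda>_. 0"]) (simp_all add: T_def)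
    show "v + w \<in> T ` l1" if "v \<in> T ` l1" "w \<in> T ` l1" for v w
      using that add l1_add by (metis (no_types, lifting) image_iff)
    show "scl s v \<in> T ` l1" if "v \<in> T ` l1" for s v
      using that scale l1_scale by (metis (no_types, lifting) image_iff)
  qed
  moreover have "bij_betw T l1 (T ` l1)" using inj by (rule inj_on_imp_bij_betw)
  moreover have "\<forall>a\<in>l1. l1_norm a \<le> 1 / c * norm (T a)"
    using lower' \<open>0 < c\<close> by (simp add: field_simps)
  ultimately show ?thesis
    unfolding contains_copy_of_l1_def using add scale upper by blast
qed

text \<open>One step of the tree. Average \<open>K\<close> signed terms of \<open>d\<close>, one for
  each pair of an index set in \<open>\<M>\<close> and a sign. The averages form a block, so by
  \<open>below\<close> they nearly attain \<open>\<delta>\<close> infinitely often at some vector of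
  the ball. By \<open>above\<close> each of the \<open>K\<close> signed values there eventually exceeds
  \<open>\<delta>\<close> by at most a small \<open>\<eta>\<close>, so none of them can fall below
  \<open>\<delta>\<close> by more than a multiple of \<open>K \<eta>\<close>: extremality of the
  average forces all its terms.\<close>
lemma oscillating_vector:
  fixes d :: "nat \<Rightarrow> 'e \<Rightarrow>\<^sub>L 'k"
  assumes dual: "\<And>n. d n \<in> dual_space scl" and norm_d: "\<And>n. norm (d n) \<le> 1" and "0 < \<delta>"
    and above: "\<And>t x. \<delta> < t \<Longrightarrow> norm x \<le> 1 \<Longrightarrow> \<forall>\<^sub>F n in sequentially. norm (d n x) \<le> t"
    and below: "\<And>t w. t < \<delta> \<Longrightarrow> l1_block w d \<Longrightarrow> \<exists>x. norm x \<le> 1 \<and> (\<exists>\<^sub>F n in sequentially. t < norm (w n x))"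
    and \<M>: "finite \<M>" "\<And>M. M \<in> \<M> \<Longrightarrow> infinite M"
  shows "\<exists>x. norm x \<le> 1 \<and> (\<forall>M\<in>\<M>. \<forall>s\<in>{1, - 1}.
    \<exists>T\<subseteq>M. infinite T \<and> (\<forall>k\<in>T. norm (d k x - of_real (s * \<delta>)) \<le> \<delta> / 4))"
proof (cases "\<M> = {}")
  case True
  then show ?thesis by (intro exI[of _ 0]) auto
next
  case False
  define I where "I = \<M> \<times> {1, - 1 :: real}"
  have I: "finite I" "I \<noteq> {}" using \<M>(1) False by (auto simp: I_def)
  define K where "K = card I"
  have K: "0 < K" "1 \<le> real K" using I by (auto simp: K_def card_gt_0_iff Suc_le_eq)
  obtain e where "bij_betw e {0..<K} I" unfolding K_def using ex_bij_betw_nat_finite[OF I(1)] by blast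
  then have e: "e i \<in> I" "e ` {0..<K} = I" if "i < K" for i
    using that by (auto simp: bij_betw_def)
  define M s where "M j = fst (e (j mod K))" and "s j = snd (e (j mod K))" for j
  have M: "M j \<in> \<M>" and s: "s j = 1 \<or> s j = - 1" for j
    using e(1)[of "j mod K"] K(1) by (auto simp: I_def M_def s_def)
  \<comment> \<open>The index sets in \<open>\<M>\<close> may overlap and each serves two signs; choosing the indices in increasing
    order still keeps those within an average distinct.\<close>
  obtain h where h: "strict_mono h" "\<And>j. h j \<in> M j"
    using increasing_choice[of M] \<M>(2)[OF M] by blast
  define w where "w n = (\<Sum>j\<in>{n * K..<Suc n * K}. (s j / K) *\<^sub>R d (h j))" for n
  have "w n \<in> interval_combs (\<lambda>j. d (h j)) (n * K) (Suc n * K) 1" for n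
  proof -
    have "(\<Sum>j\<in>{n * K..<Suc n * K}. \<bar>s j / K\<bar>) = (\<Sum>j\<in>{n * K..<Suc n * K}. 1 / K)"
    proof (rule sum.cong)
      fix j
      show "\<bar>s j / K\<bar> = 1 / K" using s[of j] by auto
    qed simp
    also have "\<dots> = 1" using K by simp
    finally show ?thesis
      unfolding interval_combs_def w_def by (intro CollectI exI[of _ "\<lambda>j. s j / K"] conjI refl)
  qed
  moreover have "strict_mono (\<lambda>n. n * K)"
    using K(1) by (auto simp: strict_mono_Suc_iff)
  ultimately have "l1_block w (\<lambda>j. d (h j))"
    unfolding l1_block_def by (intro exI[of _ "\<lambda>n. n * K"]) simp
  then have block: "l1_block w d"
    using l1_block_subseq[OF h(1)] l1_block_trans by blast
  define \<eta> where "\<eta> = \<delta> / (160 * real K)"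
  have "0 < \<eta>" using \<open>0 < \<delta>\<close> K by (simp add: \<eta>_def)
  then obtain x0 where x0: "norm x0 \<le> 1" "\<exists>\<^sub>F n in sequentially. \<delta> - \<eta> < norm (w n x0)"
    using below[of "\<delta> - \<eta>", OF _ block] by auto
  have inf: "infinite {n. \<delta> - \<eta> < norm (w n x0)}"
    using x0(2) by (simp add: frequently_cofinite flip: cofinite_eq_sequentially)
  have w_le: "norm (w n x0) \<le> 1" for n
  proof -
    have "norm (w n x0) \<le> norm (w n) * norm x0" by (rule norm_blinfun)
    also have "\<dots> \<le> 1 * 1"
      using l1_block_norm_le[OF block norm_d] x0(1) by (intro mult_mono) auto
    finally show ?thesis by simp
  qed
  obtain c N where c: "norm c = 1" and N: "N \<subseteq> {n. \<delta> - \<eta> < norm (w n x0)}" "infinite N"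
      "\<And>n. n \<in> N \<Longrightarrow> \<delta> - \<eta> - \<eta> \<le> re_part (c * w n x0)"
    using rotation_to_real_axis[of "\<lambda>n. w n x0" 1 _ "\<delta> - \<eta>" \<eta>, OF w_le inf _ \<open>0 < \<eta>\<close>]
    by (metis (mono_tags, lifting) less_imp_le mem_Collect_eq)
  define x where "x = scl c x0"
  have x: "norm x \<le> 1" using x0(1) c by (simp add: x_def norm_scl)
  have w_dual: "w n \<in> dual_space scl" for n
    using l1_block_in_subspace[OF block real_subspace_if_dual_subspace[OF dual_subspace_dual_space] dual] .
  have w_large: "\<delta> - 2 * \<eta> \<le> re_part (w n x)" if "n \<in> N" for n
    using N(3)[OF that] dual_apply_scl[OF w_dual] by (simp add: x_def)
  obtain k0 where k0: "\<And>k. k \<ge> k0 \<Longrightarrow> norm (d k x) \<le> \<delta> + \<eta>"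
    using above[OF _ x, of "\<delta> + \<eta>"] \<open>0 < \<eta>\<close> by (auto simp: eventually_sequentially)
  have good: "norm (d (h j) x - of_real (s j * \<delta>)) \<le> \<delta> / 4"
    if n: "n \<in> N" "n \<ge> k0" and j: "j \<in> {n * K..<Suc n * K}" for n j
  proof -
    have small: "norm (d (h i) x) \<le> \<delta> + \<eta>" if "i \<in> {n * K..<Suc n * K}" for i
    proof -
      have "n \<le> n * K" using K(1) by simp
      moreover have "n * K \<le> i" using that by simp
      moreover have "i \<le> h i" by (rule seq_suble[OF h(1)])
      ultimately have "k0 \<le> h i" using n(2) by linarith
      then show ?thesis by (rule k0)
    qed
    \<comment> \<open>All terms but the one with index \<open>j\<close> are bounded by \<open>\<delta> + \<eta>\<close>, which leaves a lower bound for that term.\<close>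
    have "real K * (\<delta> - 2 * \<eta>) \<le> real K * re_part (w n x)"
      using w_large[OF n(1)] by (intro mult_left_mono) auto
    also have "\<dots> = (\<Sum>i\<in>{n * K..<Suc n * K}. s i * re_part (d (h i) x))"
      using K(1) by (simp add: w_def blinfun.sum_left blinfun.scaleR_left linear_sum[OF linear_re_part]
          linear_scale[OF linear_re_part] sum_distrib_left o_def del: mult_Suc)
    also have "\<dots> = s j * re_part (d (h j) x) + (\<Sum>i\<in>{n * K..<Suc n * K} - {j}. s i * re_part (d (h i) x))"
      using j by (intro sum.remove) auto
    also have "(\<Sum>i\<in>{n * K..<Suc n * K} - {j}. s i * re_part (d (h i) x)) \<le>
        (\<Sum>i\<in>{n * K..<Suc n * K} - {j}. \<delta> + \<eta>)"
    proof (rule sum_mono)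
      fix i assume "i \<in> {n * K..<Suc n * K} - {j}"
      then have "\<bar>re_part (d (h i) x)\<bar> \<le> \<delta> + \<eta>"
        using small[of i] abs_re_part_le[of "d (h i) x"] by simp
      then show "s i * re_part (d (h i) x) \<le> \<delta> + \<eta>"
        using s[of i] by auto
    qed
    also have "(\<Sum>i\<in>{n * K..<Suc n * K} - {j}. \<delta> + \<eta>) = (real K - 1) * (\<delta> + \<eta>)"
      using j K(1) by (simp add: card_Diff_singleton of_nat_diff)
    finally have "\<delta> - 3 * real K * \<eta> + \<eta> \<le> s j * re_part (d (h j) x)"
      by (simp add: algebra_simps)
    then show ?thesis
      using \<open>0 < \<eta>\<close> small[OF j] by (intro near_signed_real[OF \<open>0 < \<delta>\<close> K(2) s \<eta>_def]) auto
  qed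
  show ?thesis
  proof (intro exI[of _ x] conjI x ballI)
    fix M' s' assume "M' \<in> \<M>" "s' \<in> {1, - (1 :: real)}"
    then have "(M', s') \<in> e ` {0..<K}" using e(2)[OF K(1)] by (auto simp: I_def)
    then obtain i where i: "i < K" "e i = (M', s')" by auto
    let ?T = "(\<lambda>n. h (n * K + i)) ` (N - {..<k0})"
    have [simp]: "M (n * K + i) = M'" "s (n * K + i) = s'" for n
      using i by (simp_all add: M_def s_def)
    have "inj (\<lambda>n. h (n * K + i))"
      using K(1) by (auto simp: inj_on_def strict_mono_eq[OF h(1)])
    moreover have "infinite (N - {..<k0})" using N(2) by simp
    ultimately have "infinite ?T"
      using finite_imageD inj_on_subset by blast
    moreover have "h (n * K + i) \<in> M'" for n
      using h(2)[of "n * K + i"] by simp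
    then have "?T \<subseteq> M'" by blast
    moreover have "norm (d k x - of_real (s' * \<delta>)) \<le> \<delta> / 4" if k: "k \<in> ?T" for k
    proof -
      obtain n where "n \<in> N - {..<k0}" "k = h (n * K + i)" using k by blast
      then show ?thesis using good[of n "n * K + i"] i(1) by simp
    qed
    ultimately show "\<exists>T\<subseteq>M'. infinite T \<and> (\<forall>k\<in>T. norm (d k x - of_real (s' * \<delta>)) \<le> \<delta> / 4)"
      by blast
  qed
qed

end

lemma pointwise_null_if_on_ball:
  fixes f :: "nat \<Rightarrow> 'a::real_normed_vector \<Rightarrow>\<^sub>L 'b::real_normed_vector"
  assumes "\<And>x. norm x \<le> 1 \<Longrightarrow> (\<lambda>n. blinfun_apply (f n) x) \<longlonglongrightarrow> 0"
  shows "(\<lambda>n. blinfun_apply (f n) x) \<longlonglongrightarrow> 0"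
proof -
  have "norm (sgn x) \<le> 1" by (simp add: norm_sgn)
  from tendsto_scaleR[OF tendsto_const assms[OF this], of "norm x"]
  show ?thesis
    by (cases "x = 0") (simp_all add: sgn_div_norm flip: blinfun.scaleR_right)
qed

context banach_space_over
begin

text \<open>The number \<open>\<delta>\<close> below is \<open>sup {limsup \<bar>d\<^sub>n x\<bar> |
  x in the ball}\<close> for a block sequence \<open>d\<close> all of whose blocks have the same
  supremum. Such a \<open>d\<close> exists because the supremum is determined by the countably many
  rational numbers that bound the sequence eventually at each point of the ball. A positive
  \<open>\<delta>\<close> would make the vectors of \<open>oscillating_vector\<close> span a copy of
  \<open>\<ell>\<^sub>1\<close>.\<close>
lemma weak_star_null_l1_block:
  fixes y :: "nat \<Rightarrow> 'e \<Rightarrow>\<^sub>L 'k"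
  assumes y: "\<And>n. y n \<in> dual_space scl" "\<And>n. norm (y n) \<le> 1" and no_l1: "\<not> contains_copy_of_l1 scl"
  obtains w where "l1_block w y" "\<And>x. (\<lambda>n. blinfun_apply (w n) x) \<longlonglongrightarrow> 0"
proof -
  define bnd where "bnd t z \<longleftrightarrow> (\<forall>x. norm x \<le> 1 \<longrightarrow> (\<forall>\<^sub>F n in sequentially. norm (blinfun_apply (z n) x) \<le> t))"
    for t and z :: "nat \<Rightarrow> 'e \<Rightarrow>\<^sub>L 'k"
  have bnd_mono: "bnd t' z" if "bnd t z" "t \<le> t'" for t t' z
    using that unfolding bnd_def by (meson eventually_mono order_trans)
  have bnd_hered: "bnd t w" if "bnd t z" "l1_block w z" for t z w
    using that l1_block_apply_le unfolding bnd_def by blast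
  have bnd_tail: "bnd t z" if "bnd t (\<lambda>n. z (n + m))" for t z m
    using that unfolding bnd_def by (simp add: eventually_sequentially_seg[of "\<lambda>n. norm (blinfun_apply (z n) _) \<le> t" m])
  let ?P = "\<lambda>i. bnd (of_rat (from_nat i))"
  have "\<exists>d. l1_block d y \<and> (\<forall>i w. l1_block w d \<longrightarrow> ?P i w \<longrightarrow> ?P i d)"
    using bnd_hered bnd_tail by (rule l1_block_stabilise)
  then obtain d where d: "l1_block d y" and stable: "\<And>i w. l1_block w d \<Longrightarrow> ?P i w \<Longrightarrow> ?P i d"
    by blast
  have d_dual: "d n \<in> dual_space scl" for n
    using l1_block_in_subspace[OF d real_subspace_if_dual_subspace[OF dual_subspace_dual_space] y(1)] .
  have d_norm: "norm (d n) \<le> 1" for n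
    using l1_block_norm_le[OF d y(2)] .
  define T where "T = {t. bnd t d}"
  have "norm (d n x) \<le> 1" if "norm x \<le> 1" for n x
    using norm_blinfun[of "d n" x] mult_mono[OF d_norm[of n] that] by simp
  then have "1 \<in> T" by (simp add: T_def bnd_def)
  have T_nonneg: "0 \<le> t" if "t \<in> T" for t
  proof -
    have "bnd t d" using that by (simp add: T_def)
    then have "norm (0 :: 'e) \<le> 1 \<longrightarrow> (\<forall>\<^sub>F n in sequentially. norm (blinfun_apply (d n) 0) \<le> t)"
      unfolding bnd_def by (rule spec)
    then show ?thesis by simp
  qed
  have bdd: "bdd_below T" using T_nonneg by (rule bdd_belowI)
  define \<delta> where "\<delta> = Inf T"
  have "0 \<le> \<delta>" unfolding \<delta>_def using \<open>1 \<in> T\<close> T_nonneg by (intro cInf_greatest) auto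
  have above: "bnd t d" if t: "\<delta> < t" for t
  proof -
    obtain t0 where "t0 \<in> T" "t0 < t"
      using cInf_lessD[of T t] t \<open>1 \<in> T\<close> unfolding \<delta>_def by blast
    then show ?thesis using bnd_mono[of t0 d t] by (simp add: T_def)
  qed
  have below: "\<exists>x. norm x \<le> 1 \<and> (\<exists>\<^sub>F n in sequentially. t < norm (blinfun_apply (w n) x))"
    if t: "t < \<delta>" and w: "l1_block w d" for t w
  proof -
    have "\<not> bnd t w"
    proof
      assume "bnd t w"
      obtain q where q: "t < of_rat q" "of_rat q < \<delta>" using of_rat_dense[OF t] by blast
      have "bnd (of_rat q) d"
        using stable[OF w, of "to_nat q"] bnd_mono[OF \<open>bnd t w\<close> less_imp_le[OF q(1)]] by simp
      then have "\<delta> \<le> of_rat q" unfolding \<delta>_def using bdd by (intro cInf_lower) (simp_all add: T_def)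
      with q(2) show False by simp
    qed
    then show ?thesis by (auto simp: bnd_def not_eventually not_le)
  qed
  have "\<not> 0 < \<delta>"
  proof
    assume "0 < \<delta>"
    define near where "near s x = {k. norm (d k x - of_real (s * \<delta>)) \<le> \<delta> / 4}" for s :: real and x
    \<comment> \<open>The nodes of the tree are infinite sets of indices of \<open>d\<close>; no further state is carried.\<close>
    define G where "G \<M> u \<longleftrightarrow> finite \<M> \<and> (\<forall>M\<in>\<M>. infinite M)" for \<M> :: "nat set set" and u :: unit
    have step: "\<exists>x \<T> t. G \<T> t \<and> norm x \<le> 1 \<and>
        (\<forall>M\<in>\<M>. (\<exists>T\<in>\<T>. T \<subseteq> M \<inter> near 1 x) \<and> (\<exists>T\<in>\<T>. T \<subseteq> M \<inter> near (- 1) x))" if "G \<M> u" for \<M> u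
    proof -
      have \<M>: "finite \<M>" "\<And>M. M \<in> \<M> \<Longrightarrow> infinite M" using that by (auto simp: G_def)
      have "\<forall>\<^sub>F n in sequentially. norm (blinfun_apply (d n) x) \<le> t" if "\<delta> < t" "norm x \<le> 1" for t x
        using above[OF that(1)] that(2) unfolding bnd_def by blast
      with d_dual d_norm \<open>0 < \<delta>\<close> have "\<exists>x. norm x \<le> 1 \<and> (\<forall>M\<in>\<M>. \<forall>s\<in>{1, - 1}.
          \<exists>T\<subseteq>M. infinite T \<and> (\<forall>k\<in>T. norm (d k x - of_real (s * \<delta>)) \<le> \<delta> / 4))"
        using below \<M> by (rule oscillating_vector)
      then obtain x where x: "norm x \<le> 1" "\<And>M s. M \<in> \<M> \<Longrightarrow> s \<in> {1, - 1} \<Longrightarrow>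
          \<exists>T\<subseteq>M. infinite T \<and> (\<forall>k\<in>T. norm (d k x - of_real (s * \<delta>)) \<le> \<delta> / 4)"
        by blast
      let ?T = "(\<lambda>M. M \<inter> near 1 x) ` \<M> \<union> (\<lambda>M. M \<inter> near (- 1) x) ` \<M>"
      have "infinite (M \<inter> near s x)" if Ms: "M \<in> \<M>" "s \<in> {1, - 1}" for M s
      proof -
        obtain T where "T \<subseteq> M" "infinite T" "\<forall>k\<in>T. norm (d k x - of_real (s * \<delta>)) \<le> \<delta> / 4"
          using x(2)[OF Ms] by blast
        then have "T \<subseteq> M \<inter> near s x" by (auto simp: near_def)
        with \<open>infinite T\<close> show ?thesis using infinite_super by blast
      qed
      then have "G ?T u" using \<M>(1) by (auto simp: G_def)
      with x(1) show ?thesis by (intro exI[of _ x] exI[of _ ?T] exI[of _ u]) blast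
    qed
    have start: "G {UNIV} ()" "{UNIV} \<noteq> ({} :: nat set set)" by (auto simp: G_def)
    have nonempty: "M \<noteq> {}" if "G \<M> u" "M \<in> \<M>" for \<M> u M
      using that by (auto simp: G_def)
    have "\<exists>x :: nat \<Rightarrow> 'e. (\<forall>j. norm (x j) \<le> 1) \<and>
      (\<forall>N \<sigma>. \<exists>k. \<forall>j<N. k \<in> (if \<sigma> j then near 1 (x j) else near (- 1) (x j)))"
    proof (rule independent_sequence[of G "{UNIV}" "()" "\<lambda>_ x _. norm x \<le> 1" "near 1" "near (- 1)",
          OF start nonempty step])
      fix x :: "nat \<Rightarrow> 'e"
      assume "\<And>j. norm (x j) \<le> 1"
        "\<And>N \<sigma>. \<exists>S\<in>{UNIV}. \<exists>k\<in>S. \<forall>j<N. k \<in> (if \<sigma> j then near 1 (x j) else near (- 1) (x j))"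
      then show ?thesis by (intro exI[of _ x]) simp
    qed
    then obtain x :: "nat \<Rightarrow> 'e" where x: "\<And>j. norm (x j) \<le> 1"
      "\<And>N \<sigma>. \<exists>k. \<forall>j<N. k \<in> (if \<sigma> j then near 1 (x j) else near (- 1) (x j))"
      by blast
    have lower: "\<delta> / 4 * (\<Sum>j<N. norm (a j)) \<le> norm (\<Sum>j<N. scl (a j) (x j))" for a :: "nat \<Rightarrow> 'k" and N
    proof -
      obtain \<sigma> :: "nat \<Rightarrow> bool" where
        \<sigma>: "(\<Sum>j<N. norm (a j)) \<le> 2 * norm (\<Sum>j<N. of_real (if \<sigma> j then 1 else - 1) * a j)"
        using sign_choice by blast
      obtain k where k: "\<And>j. j < N \<Longrightarrow> k \<in> (if \<sigma> j then near 1 (x j) else near (- 1) (x j))"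
        using x(2) by blast
      define s where "s j = (if \<sigma> j then 1 else - 1 :: real)" for j
      have close: "norm (d k (x j) - of_real (s j * \<delta>)) \<le> \<delta> / 4" if "j < N" for j
        using k[OF that] by (auto simp: s_def near_def split: if_splits)
      \<comment> \<open>The main term is at least half of \<open>\<delta> \<Sum> norm (a j)\<close>, the error at most a quarter of it.\<close>
      have "(\<Sum>j<N. a j * d k (x j)) =
          of_real \<delta> * (\<Sum>j<N. of_real (s j) * a j) + (\<Sum>j<N. a j * (d k (x j) - of_real (s j * \<delta>)))"
        by (simp add: sum_distrib_left sum.distrib[symmetric] algebra_simps)
      then have "of_real \<delta> * (\<Sum>j<N. of_real (s j) * a j) =
          (\<Sum>j<N. a j * d k (x j)) - (\<Sum>j<N. a j * (d k (x j) - of_real (s j * \<delta>)))"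
        by (simp only: add_diff_cancel_right')
      then have "norm (of_real \<delta> * (\<Sum>j<N. of_real (s j) * a j)) \<le>
          norm (\<Sum>j<N. a j * d k (x j)) + norm (\<Sum>j<N. a j * (d k (x j) - of_real (s j * \<delta>)))"
        by (simp only: norm_triangle_ineq4)
      moreover have "norm (\<Sum>j<N. a j * (d k (x j) - of_real (s j * \<delta>))) \<le> (\<Sum>j<N. \<delta> / 4 * norm (a j))"
      proof (rule sum_norm_le)
        fix j assume "j \<in> {..<N}"
        then show "norm (a j * (d k (x j) - of_real (s j * \<delta>))) \<le> \<delta> / 4 * norm (a j)"
          using mult_left_mono[OF close[of j], of "norm (a j)"] by (simp only: norm_mult mult.commute lessThan_iff norm_ge_zero simp_thms)
      qed
      then have "norm (\<Sum>j<N. a j * (d k (x j) - of_real (s j * \<delta>))) \<le> \<delta> / 4 * (\<Sum>j<N. norm (a j))"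
        by (simp only: sum_distrib_left)
      moreover have "\<delta> / 2 * (\<Sum>j<N. norm (a j)) \<le> norm (of_real \<delta> * (\<Sum>j<N. of_real (s j) * a j))"
      proof -
        have "norm (of_real \<delta> * (\<Sum>j<N. of_real (s j) * a j)) = \<delta> * norm (\<Sum>j<N. of_real (s j) * a j)"
          using \<open>0 < \<delta>\<close> by (simp only: norm_mult norm_of_real abs_of_pos)
        moreover have "\<delta> / 2 * (\<Sum>j<N. norm (a j)) \<le> \<delta> / 2 * (2 * norm (\<Sum>j<N. of_real (s j) * a j))"
          using \<sigma> \<open>0 < \<delta>\<close> unfolding s_def by (intro mult_left_mono) simp_all
        ultimately show ?thesis by simp
      qed
      ultimately have "\<delta> / 2 * (\<Sum>j<N. norm (a j)) \<le>
          norm (\<Sum>j<N. a j * d k (x j)) + \<delta> / 4 * (\<Sum>j<N. norm (a j))"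
        by linarith
      then have "\<delta> / 4 * (\<Sum>j<N. norm (a j)) \<le> norm (\<Sum>j<N. a j * d k (x j))"
        by (simp add: field_simps)
      also have "(\<Sum>j<N. a j * d k (x j)) = d k (\<Sum>j<N. scl (a j) (x j))"
        by (simp add: blinfun.sum_right dual_apply_scl[OF d_dual])
      also have "norm \<dots> \<le> norm (d k) * norm (\<Sum>j<N. scl (a j) (x j))"
        by (rule norm_blinfun)
      also have "\<dots> \<le> 1 * norm (\<Sum>j<N. scl (a j) (x j))"
        by (intro mult_right_mono d_norm) simp
      finally show ?thesis by simp
    qed
    have "contains_copy_of_l1 scl"
      using contains_copy_of_l1I[of x "\<delta> / 4"] x(1) lower \<open>0 < \<delta>\<close> by simp
    with no_l1 show False ..
  qed
  with \<open>0 \<le> \<delta>\<close> have "\<delta> = 0" by simp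
  have unit: "(\<lambda>n. blinfun_apply (d n) x) \<longlonglongrightarrow> 0" if "norm x \<le> 1" for x
  proof (rule tendsto_norm_zero_cancel, rule order_tendstoI)
    fix e :: real assume "0 < e"
    then have "\<forall>\<^sub>F n in sequentially. norm (blinfun_apply (d n) x) \<le> e / 2"
      using above[of "e / 2"] that \<open>\<delta> = 0\<close> unfolding bnd_def by simp
    then show "\<forall>\<^sub>F n in sequentially. norm (blinfun_apply (d n) x) < e"
      by (rule eventually_mono) (use \<open>0 < e\<close> in simp)
  next
    fix e :: real assume "e < 0"
    then show "\<forall>\<^sub>F n in sequentially. e < norm (blinfun_apply (d n) x)"
      by (intro always_eventually allI) (rule less_le_trans, assumption, simp)
  qed
  have "(\<lambda>n. blinfun_apply (d n) x) \<longlonglongrightarrow> 0" for x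
    using unit by (rule pointwise_null_if_on_ball)
  with d show thesis by (rule that)
qed

lemma weak_star_null_difference:
  fixes y :: "nat \<Rightarrow> 'e \<Rightarrow>\<^sub>L 'k"
  assumes y: "\<And>n. y n \<in> dual_space scl"
    and conv: "\<And>x. norm x \<le> 1 \<Longrightarrow> convergent (\<lambda>n. re_part (y n x))"
  shows "(\<lambda>n. blinfun_apply (y (Suc n) - y n) x) \<longlonglongrightarrow> 0"
proof -
  have re: "(\<lambda>n. re_part (blinfun_apply (y (Suc n) - y n) x)) \<longlonglongrightarrow> 0" if x: "norm x \<le> 1" for x
  proof -
    obtain l where "(\<lambda>n. re_part (y n x)) \<longlonglongrightarrow> l" using conv[OF x] by (auto simp: convergent_def)
    from tendsto_diff[OF LIMSEQ_Suc[OF this] this] show ?thesis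
      by (simp add: blinfun.diff_left linear_diff[OF linear_re_part])
  qed
  obtain j :: 'k where j: "norm j = 1" "\<And>t. norm t \<le> \<bar>re_part t\<bar> + \<bar>re_part (j * t)\<bar>"
    using norm_le_re_parts by blast
  have unit: "(\<lambda>n. blinfun_apply (y (Suc n) - y n) x) \<longlonglongrightarrow> 0" if x: "norm x \<le> 1" for x
  proof -
    have "norm (scl j x) \<le> 1" using x by (simp add: norm_scl j(1))
    from re[OF this] have "(\<lambda>n. re_part (j * blinfun_apply (y (Suc n) - y n) x)) \<longlonglongrightarrow> 0"
      by (simp add: blinfun.diff_left dual_apply_scl[OF y] right_diff_distrib)
    from tendsto_add_zero[OF tendsto_rabs_zero[OF re[OF x]] tendsto_rabs_zero[OF this]]
    show ?thesis
      by (rule Lim_null_comparison[rotated]) (intro always_eventually allI j(2))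
  qed
  then show ?thesis by (rule pointwise_null_if_on_ball)
qed

text \<open>A strengthening of the theorem of Josefson and Nissenzweig for spaces without copies of
  \<open>\<ell>\<^sub>1\<close>: the sequence is found in the prescribed subspace.\<close>
theorem weak_star_null_bounded_below_sequence:
  fixes F :: "('e \<Rightarrow>\<^sub>L 'k) set"
  assumes no_l1: "\<not> contains_copy_of_l1 scl"
    and F: "dual.subspace F" "F \<subseteq> dual_space scl" "infinite_dimensional dual_scale F"
  obtains f \<epsilon> where "\<And>n. f n \<in> F" "\<And>n. norm (f n) \<le> 2" "0 < \<epsilon>" "\<And>n. \<epsilon> \<le> norm (f n)"
    "\<And>x. (\<lambda>n. blinfun_apply (f n) x) \<longlonglongrightarrow> 0"
proof -
  obtain y :: "nat \<Rightarrow> 'e \<Rightarrow>\<^sub>L 'k" where y: "\<And>n. y n \<in> F" "\<And>n. norm (y n) = 1"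
    "\<And>m n. m \<noteq> n \<Longrightarrow> 1 / 2 \<le> norm (y m - y n)"
    using separated_unit_functionals[OF F(1,3)] by blast
  have "bounded (range (\<lambda>n. re_part (blinfun_apply (y n) x)))" if "x \<in> cball 0 1" for x
  proof (rule boundedI)
    fix t assume "t \<in> range (\<lambda>n. re_part (blinfun_apply (y n) x))"
    then obtain n where "t = re_part (y n x)" by blast
    then show "norm t \<le> 1"
      using abs_re_part_le[of "y n x"] norm_blinfun[of "y n" x] that by (simp add: y(2))
  qed
  then have "(\<exists>r :: nat \<Rightarrow> nat. strict_mono r \<and>
        (\<forall>x\<in>cball 0 1. convergent (\<lambda>n. re_part (blinfun_apply (y (r n)) x)))) \<or>
      (\<exists>(r :: nat \<Rightarrow> nat) a b. strict_mono r \<and> a < b \<and> (\<forall>N \<sigma>. \<exists>x\<in>cball 0 1. \<forall>j<N.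
        if \<sigma> j then b \<le> re_part (blinfun_apply (y (r j)) x) else re_part (blinfun_apply (y (r j)) x) \<le> a))"
    by (rule rosenthal_dichotomy)
  then show thesis
  proof (elim disjE exE conjE)
    fix r :: "nat \<Rightarrow> nat"
    assume r: "strict_mono r" "\<forall>x\<in>cball 0 1. convergent (\<lambda>n. re_part (blinfun_apply (y (r n)) x))"
    define f where "f n = y (r (Suc n)) - y (r n)" for n
    show thesis
    proof (rule that[of f "1 / 2"])
      show "f n \<in> F" for n
        unfolding f_def by (rule dual.subspace_diff[OF F(1) y(1) y(1)])
      show "norm (f n) \<le> 2" for n
        using norm_triangle_ineq4[of "y (r (Suc n))" "y (r n)"] by (simp add: f_def y(2))
      show "1 / 2 \<le> norm (f n)" for n
        unfolding f_def using strict_mono_eq[OF r(1)] by (intro y(3)) simp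
      have "y (r n) \<in> dual_space scl" for n using F(2) y(1) by blast
      then show "(\<lambda>n. blinfun_apply (f n) x) \<longlonglongrightarrow> 0" for x
        unfolding f_def using r(2) by (intro weak_star_null_difference[of "\<lambda>n. y (r n)"]) auto
    qed simp
  next
    fix r :: "nat \<Rightarrow> nat" and a b :: real
    assume r: "strict_mono r" "a < b" "\<forall>N \<sigma>. \<exists>x\<in>cball 0 1. \<forall>j<N.
        if \<sigma> j then b \<le> re_part (blinfun_apply (y (r j)) x) else re_part (blinfun_apply (y (r j)) x) \<le> a"
    have lower: "(b - a) / 2 * (\<Sum>i<N. \<bar>\<alpha> i\<bar>) \<le> norm (\<Sum>i<N. \<alpha> i *\<^sub>R y (r i))" for \<alpha> N
      using r(3) by (intro l1_lower_bound_if_independent[OF r(2)]) (simp add: Bex_def)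
    have "y (r n) \<in> dual_space scl" "norm (y (r n)) \<le> 1" for n using F(2) y by auto
    from weak_star_null_l1_block[of "\<lambda>n. y (r n)", OF this no_l1] obtain w
      where w: "l1_block w (\<lambda>n. y (r n))" "\<And>x. (\<lambda>n. blinfun_apply (w n) x) \<longlonglongrightarrow> 0"
      by blast
    show thesis
    proof (rule that[of w "(b - a) / 2"])
      show "w n \<in> F" for n
        by (rule l1_block_in_subspace[OF w(1) real_subspace_if_dual_subspace[OF F(1)] y(1)])
      show "norm (w n) \<le> 2" for n
        using l1_block_norm_le[OF w(1), of 1 n] y(2) by simp
      show "(b - a) / 2 \<le> norm (w n)" for n
        by (rule l1_block_norm_ge[OF w(1) lower])
    qed (use r(2) w(2) in auto)
  qed
qed

end

section \<open>Weak* convergence and bounded sequences\<close>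
lemma limitin_weak_star_iff:
  fixes f :: "nat \<Rightarrow> 'e::banach \<Rightarrow>\<^sub>L 'k::real_or_complex"
  shows "limitin (weak_star_topology scl) f 0 sequentially \<longleftrightarrow>
     (\<forall>\<^sub>F n in sequentially. f n \<in> dual_space scl) \<and> (\<forall>x. (\<lambda>n. blinfun_apply (f n) x) \<longlonglongrightarrow> 0)"
proof -
  have zero: "0 \<in> dual_space scl" by (simp add: dual_space_def)
  have "limitin strong_operator_topology f 0 sequentially \<longleftrightarrow> (\<forall>x. (\<lambda>n. blinfun_apply (f n) x) \<longlonglongrightarrow> 0)"
  proof
    assume lim: "limitin strong_operator_topology f 0 sequentially"
    show "\<forall>x. (\<lambda>n. blinfun_apply (f n) x) \<longlonglongrightarrow> 0"
    proof
      fix x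
      show "(\<lambda>n. blinfun_apply (f n) x) \<longlonglongrightarrow> 0"
        using continuous_map_limit[OF strong_operator_topology_continuous_evaluation lim, of x]
        by (simp add: o_def)
    qed
  next
    assume null: "\<forall>x. (\<lambda>n. blinfun_apply (f n) x) \<longlonglongrightarrow> 0"
    have lim: "(\<lambda>n. blinfun_apply (f n)) \<longlonglongrightarrow> blinfun_apply 0"
      using null limitin_componentwise[of "\<lambda>_. euclidean" UNIV "\<lambda>n. blinfun_apply (f n)" "blinfun_apply 0"]
      by (simp add: euclidean_product_topology)
    show "limitin strong_operator_topology f 0 sequentially"
      unfolding limitin_def
    proof (intro conjI allI impI)
      fix U :: "('e \<Rightarrow>\<^sub>L 'k) set" assume "openin strong_operator_topology U \<and> 0 \<in> U"
      then obtain V where "open V" "U = blinfun_apply -` V" "blinfun_apply 0 \<in> V"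
        unfolding strong_operator_topology_def openin_pullback_topology by auto
      with topological_tendstoD[OF lim, of V] show "\<forall>\<^sub>F n in sequentially. f n \<in> U"
        by simp
    qed (simp add: strong_operator_topology_topspace)
  qed
  then show ?thesis
    using zero by (simp add: weak_star_topology_def limitin_subtopology)
qed

lemma norm_dual_scale: "norm (dual_scale c f) = norm c * norm f"
proof (cases "c = 0")
  case False
  have "norm c * norm f = norm c * norm (dual_scale (inverse c) (dual_scale c f))"
    using False by simp
  also have "\<dots> \<le> norm c * (norm (inverse c) * norm (dual_scale c f))"
    by (intro mult_left_mono norm_dual_scale_le) simp
  also have "\<dots> = norm (dual_scale c f)"
    using False by (simp add: norm_inverse)
  finally have "norm c * norm f \<le> norm (dual_scale c f)" .
  then show ?thesis using norm_dual_scale_le[of c f] by simp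
qed simp

interpretation linf: vector_space linf_scale
  by (rule vector_space_linf_scale)

lemma bounded_sequence_as_bcontfun:
  fixes g :: "nat \<Rightarrow> 'v::real_normed_vector"
  assumes "\<And>j. norm (g j) \<le> C"
  obtains z where "apply_bcontfun z = g"
proof -
  have "g \<in> bcontfun" using assms by (intro bcontfun_normI) auto
  then show thesis using that by (metis Bcontfun_inverse)
qed

lemma tendsto_apply_bcontfun:
  assumes "f \<longlonglongrightarrow> l"
  shows "(\<lambda>n. apply_bcontfun (f n) j) \<longlonglongrightarrow> apply_bcontfun l j"
  by (rule metric_tendsto_imp_tendsto[OF assms]) (auto intro!: always_eventually dist_bounded)

section \<open>The subspace of blockwise multiples\<close>

text \<open>The classes are the fibres of \<open>fst \<circ> prod_decode\<close>, a partition of the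
  indices into infinitely many infinite sets. If the norms of \<open>y\<close> are bounded below,
  the boundedness of the product makes the multiplier \<open>c\<close> bounded.\<close>
definition block_multiples :: "(nat \<Rightarrow> 'e::banach \<Rightarrow>\<^sub>L 'k::real_or_complex) \<Rightarrow> (nat \<Rightarrow>\<^sub>C ('e \<Rightarrow>\<^sub>L 'k)) set" where
  "block_multiples y = {z. \<exists>c. \<forall>j. apply_bcontfun z j = dual_scale (c (fst (prod_decode j))) (y j)}"

lemma subspace_block_multiples: "linf.subspace (block_multiples y)"
proof (rule linf.subspaceI)
  show "0 \<in> block_multiples y"
    unfolding block_multiples_def by (intro CollectI exI[of _ "\<lambda>_. 0"]) simp
next
  fix z z' assume "z \<in> block_multiples y" "z' \<in> block_multiples y"
  then obtain c c' where "\<And>j. apply_bcontfun z j = dual_scale (c (fst (prod_decode j))) (y j)"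
    "\<And>j. apply_bcontfun z' j = dual_scale (c' (fst (prod_decode j))) (y j)"
    unfolding block_multiples_def by blast
  then show "z + z' \<in> block_multiples y"
    unfolding block_multiples_def
    by (intro CollectI exI[of _ "\<lambda>i. c i + c' i"]) (simp add: dual.scale_left_distrib)
next
  fix s z assume "z \<in> block_multiples y"
  then obtain c where "\<And>j. apply_bcontfun z j = dual_scale (c (fst (prod_decode j))) (y j)"
    unfolding block_multiples_def by blast
  then show "linf_scale s z \<in> block_multiples y"
    unfolding block_multiples_def
    by (intro CollectI exI[of _ "\<lambda>i. s * c i"]) simp
qed

text \<open>Evaluating one nonzero term of each class at a suitable vector recovers the multiplier,
  so the multipliers of a convergent sequence converge as well.\<close>
lemma closed_block_multiples:
  assumes "\<And>j. y j \<noteq> 0"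
  shows "closed (block_multiples y)"
  unfolding closed_sequential_limits
proof (intro allI impI)
  fix f l assume "(\<forall>n. f n \<in> block_multiples y) \<and> f \<longlonglongrightarrow> l"
  then have lim: "f \<longlonglongrightarrow> l" and
    "\<forall>n. \<exists>c. \<forall>j. apply_bcontfun (f n) j = dual_scale (c (fst (prod_decode j))) (y j)"
    unfolding block_multiples_def by auto
  then obtain c where c: "\<And>n j. apply_bcontfun (f n) j = dual_scale (c n (fst (prod_decode j))) (y j)"
    by metis
  have limj: "(\<lambda>n. c n (fst (prod_decode j)) * blinfun_apply (y j) e) \<longlonglongrightarrow> blinfun_apply (apply_bcontfun l j) e" for j e
    using blinfun.tendsto[OF tendsto_apply_bcontfun[OF lim, of j] tendsto_const[of e]]
    by (simp add: c)
  have "\<exists>a. (\<lambda>n. c n i) \<longlonglongrightarrow> a" for i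
  proof -
    let ?j = "prod_encode (i, 0)"
    obtain e where e: "blinfun_apply (y ?j) e \<noteq> 0"
      using assms[of ?j] by (metis blinfun_eqI zero_blinfun.rep_eq)
    from tendsto_divide[OF limj[of ?j e] tendsto_const e]
    show ?thesis using e by auto
  qed
  then obtain a where a: "\<And>i. (\<lambda>n. c n i) \<longlonglongrightarrow> a i" by metis
  have "apply_bcontfun l j = dual_scale (a (fst (prod_decode j))) (y j)" for j
  proof (rule blinfun_eqI)
    fix e
    show "blinfun_apply (apply_bcontfun l j) e = blinfun_apply (dual_scale (a (fst (prod_decode j))) (y j)) e"
      using LIMSEQ_unique[OF limj[of j e] tendsto_mult[OF a tendsto_const]] by simp
  qed
  then show "l \<in> block_multiples y" unfolding block_multiples_def by blast
qed

text \<open>The restrictions of \<open>y\<close> to the single classes are linearly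
  independent.\<close>
lemma infinite_dimensional_block_multiples:
  assumes nonzero: "\<And>j. y j \<noteq> 0" and bound: "\<And>j. norm (y j) \<le> C"
  shows "infinite_dimensional linf_scale (block_multiples y)"
  unfolding infinite_dimensional_def
proof
  assume "\<exists>S. finite S \<and> block_multiples y \<subseteq> linf.span S"
  then obtain S where S: "finite S" "block_multiples y \<subseteq> linf.span S" by blast
  have "\<exists>z. \<forall>j. apply_bcontfun z j = (if fst (prod_decode j) = i then y j else 0)" for i
  proof -
    have "norm (if fst (prod_decode j) = i then y j else 0) \<le> C" for j
      using bound[of j] norm_ge_zero[of "y j"] by (auto simp del: norm_ge_zero)
    then obtain z where "apply_bcontfun z = (\<lambda>j. if fst (prod_decode j) = i then y j else 0)"
      by (rule bounded_sequence_as_bcontfun)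
    then show ?thesis by (intro exI[of _ z]) simp
  qed
  then have "\<forall>i. \<exists>z. \<forall>j. apply_bcontfun z j = (if fst (prod_decode j) = i then y j else 0)" by (rule allI)
  from choice[OF this] obtain w
    where w: "\<And>i j. apply_bcontfun (w i) j = (if fst (prod_decode j) = i then y j else 0)"
    by blast
  have "w i \<in> block_multiples y" for i
    unfolding block_multiples_def
    by (intro CollectI exI[of _ "\<lambda>k. if k = i then 1 else 0"]) (simp add: w)
  then have "w i \<in> linf.span S" for i by (rule subsetD[OF S(2)])
  then have sub: "w ` A \<subseteq> linf.span S" for A by (rule image_subsetI)
  have at: "apply_bcontfun (w i) (prod_encode (k, 0)) = (if k = i then y (prod_encode (k, 0)) else 0)" for i k
    by (simp add: w)
  have inj: "inj w"
  proof
    fix i k assume "w i = w k"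
    then have "apply_bcontfun (w i) (prod_encode (i, 0)) = apply_bcontfun (w k) (prod_encode (i, 0))" by simp
    then show "i = k" using nonzero[of "prod_encode (i, 0)"] by (auto simp: at split: if_splits)
  qed
  define A where "A = w ` {..card S}"
  have A: "finite A" "card A = Suc (card S)"
    using inj by (simp_all add: A_def card_image inj_on_subset)
  have "linf.independent A"
  proof (rule linf.independent_if_scalars_zero[OF A(1)])
    fix g v assume sum: "(\<Sum>v\<in>A. linf_scale (g v) v) = 0" and "v \<in> A"
    then obtain k where k: "k \<le> card S" "v = w k" by (auto simp: A_def)
    let ?j = "prod_encode (k, 0)"
    have app: "apply_bcontfun (\<Sum>i\<in>B. h i) j = (\<Sum>i\<in>B. apply_bcontfun (h i) j)" if "finite B" for B and h :: "nat \<Rightarrow> _" and j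
      using that by (induction B rule: finite_induct) auto
    have "0 = apply_bcontfun (\<Sum>v\<in>A. linf_scale (g v) v) ?j" by (simp add: sum)
    also have "(\<Sum>v\<in>A. linf_scale (g v) v) = (\<Sum>i\<in>{..card S}. linf_scale (g (w i)) (w i))"
      unfolding A_def using inj by (subst sum.reindex) (auto intro: inj_on_subset)
    also have "apply_bcontfun \<dots> ?j = (\<Sum>i\<in>{..card S}. if k = i then dual_scale (g v) (y ?j) else 0)"
      unfolding app[OF finite_atMost] by (intro sum.cong) (auto simp: at k(2))
    also have "\<dots> = dual_scale (g v) (y ?j)" using k(1) by simp
    finally show "g v = 0" using nonzero[of ?j] by (simp add: dual.scale_eq_0_iff)
  qed
  from linf.independent_span_bound[OF S(1) this] sub show False
    using A(2) by (auto simp: A_def)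
qed

lemma spaceable_subsequence:
  fixes x :: "nat \<Rightarrow>\<^sub>C ('e::banach \<Rightarrow>\<^sub>L 'k::real_or_complex)"
  assumes F: "dual.subspace F" and x: "x \<in> linf F"
    and null: "\<And>e. (\<lambda>n. blinfun_apply (apply_bcontfun x n) e) \<longlonglongrightarrow> 0"
    and not_norm_null: "\<not> apply_bcontfun x \<longlonglongrightarrow> 0"
  obtains W w and r :: "nat \<Rightarrow> nat"
  where "closed_subspace_of linf_scale (linf F) W" "infinite_dimensional linf_scale W"
    "\<And>z e. z \<in> W \<Longrightarrow> (\<lambda>n. blinfun_apply (apply_bcontfun z n) e) \<longlonglongrightarrow> 0"
    "\<And>z. z \<in> W \<Longrightarrow> z \<noteq> 0 \<Longrightarrow> \<not> apply_bcontfun z \<longlonglongrightarrow> 0"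
    "w \<in> W" "strict_mono r" "apply_bcontfun w = apply_bcontfun x \<circ> r"
proof -
  obtain \<epsilon> where \<epsilon>: "0 < \<epsilon>" "\<not> (\<forall>\<^sub>F n in sequentially. norm (apply_bcontfun x n) < \<epsilon>)"
    using not_norm_null unfolding tendsto_iff by auto
  then have "infinite {n. \<epsilon> \<le> norm (apply_bcontfun x n)}"
    by (simp add: not_less frequently_cofinite not_eventually flip: cofinite_eq_sequentially)
  then obtain r :: "nat \<Rightarrow> nat" where r: "strict_mono r" "\<And>n. \<epsilon> \<le> norm (apply_bcontfun x (r n))"
    using infinite_enumerate by (metis (mono_tags, lifting) mem_Collect_eq)
  define y where "y n = apply_bcontfun x (r n)" for n
  have y_ge: "\<epsilon> \<le> norm (y n)" and y_le: "norm (y n) \<le> norm x" and y_F: "y n \<in> F" for n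
    using r(2) norm_bounded[of x] x by (auto simp: y_def linf_def)
  have y_nz: "y n \<noteq> 0" for n using y_ge[of n] \<epsilon>(1) by auto
  have y_null: "(\<lambda>n. blinfun_apply (y n) e) \<longlonglongrightarrow> 0" for e
    using LIMSEQ_subseq_LIMSEQ[OF null r(1), of e] by (simp add: y_def o_def)
  let ?W = "block_multiples y"
  have W_F: "?W \<subseteq> linf F"
  proof
    fix z assume "z \<in> ?W"
    then obtain c where "\<And>j. apply_bcontfun z j = dual_scale (c (fst (prod_decode j))) (y j)"
      unfolding block_multiples_def by blast
    then have "apply_bcontfun z j \<in> F" for j
      using dual.subspace_scale[OF F y_F] by simp
    then show "z \<in> linf F" by (auto simp: linf_def)
  qed
  obtain w where w: "apply_bcontfun w = y" by (rule bounded_sequence_as_bcontfun[OF y_le])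
  show thesis
  proof (rule that[of ?W w r])
    show "closed_subspace_of linf_scale (linf F) ?W"
      unfolding closed_subspace_of_def
      using subspace_block_multiples W_F closed_subset[OF W_F closed_block_multiples[of y, OF y_nz]] by blast
    show "infinite_dimensional linf_scale ?W"
      using y_nz y_le by (rule infinite_dimensional_block_multiples)
    show "w \<in> ?W"
      unfolding block_multiples_def by (intro CollectI exI[of _ "\<lambda>_. 1"]) (simp add: w)
    show "strict_mono r" by fact
    show "apply_bcontfun w = apply_bcontfun x \<circ> r" by (auto simp: w y_def)
  next
    fix z assume "z \<in> ?W"
    then obtain c where c: "\<And>j. apply_bcontfun z j = dual_scale (c (fst (prod_decode j))) (y j)"
      unfolding block_multiples_def by blast
    show "(\<lambda>n. blinfun_apply (apply_bcontfun z n) e) \<longlonglongrightarrow> 0" for e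
    proof (rule tendsto_0_le[OF y_null[of e]])
      have "norm (c (fst (prod_decode j))) \<le> norm z / \<epsilon>" for j
      proof -
        have "norm (c (fst (prod_decode j))) * \<epsilon> \<le> norm (c (fst (prod_decode j))) * norm (y j)"
          by (intro mult_left_mono y_ge) simp
        also have "\<dots> = norm (apply_bcontfun z j)" by (simp add: c norm_dual_scale)
        also have "\<dots> \<le> norm z" by (rule norm_bounded)
        finally show ?thesis using \<epsilon>(1) by (simp add: field_simps)
      qed
      then show "\<forall>\<^sub>F n in sequentially. norm (blinfun_apply (apply_bcontfun z n) e) \<le>
          norm (blinfun_apply (y n) e) * (norm z / \<epsilon>)"
        by (intro always_eventually allI)
          (simp only: c dual_scale_apply norm_mult mult.commute[of "norm (blinfun_apply _ e)"] mult_right_mono norm_ge_zero)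
    qed
    show "\<not> apply_bcontfun z \<longlonglongrightarrow> 0" if "z \<noteq> 0"
    proof
      assume lim: "apply_bcontfun z \<longlonglongrightarrow> 0"
      have "\<exists>i. c i \<noteq> 0"
      proof (rule ccontr)
        assume "\<not> (\<exists>i. c i \<noteq> 0)"
        then have "z = 0" by (intro bcontfun_eqI) (simp add: c)
        with \<open>z \<noteq> 0\<close> show False ..
      qed
      then obtain i where i: "c i \<noteq> 0" ..
      then have "0 < norm (c i) * \<epsilon>" using \<epsilon>(1) by simp
      then obtain N where N: "\<And>n. n \<ge> N \<Longrightarrow> norm (apply_bcontfun z n) < norm (c i) * \<epsilon>"
        using LIMSEQ_D[OF lim] by force
      have "norm (apply_bcontfun z (prod_encode (i, N))) < norm (c i) * \<epsilon>"
        by (rule N) (rule le_prod_encode_2)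
      moreover have "norm (c i) * \<epsilon> \<le> norm (c i) * norm (y (prod_encode (i, N)))"
        by (intro mult_left_mono y_ge) simp
      ultimately show False by (simp add: c norm_dual_scale)
    qed
  qed
qed

theorem corollary3p6:
  fixes scl :: "'k::real_or_complex \<Rightarrow> 'e::banach \<Rightarrow> 'e"
    and F :: "('e \<Rightarrow>\<^sub>L 'k) set"
  assumes "banach_space_over scl"
    and "\<not> contains_copy_of_l1 scl"
    and "closed_subspace_of dual_scale (dual_space scl) F"
    and "infinite_dimensional dual_scale F"
  shows "almost_pointwise_spaceable linf_scale apply_bcontfun (linf F)
    {x \<in> linf F. limitin (weak_star_topology scl) (apply_bcontfun x) 0 sequentially \<and>
                 \<not> apply_bcontfun x \<longlonglongrightarrow> 0}"
proof -
  interpret banach_space_over scl by fact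
  have F: "dual.subspace F" "F \<subseteq> dual_space scl"
    using assms(3) by (auto simp: closed_subspace_of_def)
  define C where "C = {x \<in> linf F. limitin (weak_star_topology scl) (apply_bcontfun x) 0 sequentially \<and>
                 \<not> apply_bcontfun x \<longlonglongrightarrow> 0}"
  have C_iff: "x \<in> C \<longleftrightarrow> x \<in> linf F \<and> (\<forall>e. (\<lambda>n. blinfun_apply (apply_bcontfun x n) e) \<longlonglongrightarrow> 0) \<and>
      \<not> apply_bcontfun x \<longlonglongrightarrow> 0" for x
    using F(2) by (auto simp: C_def limitin_weak_star_iff linf_def intro!: always_eventually)
  have "C \<noteq> {}"
  proof -
    obtain f \<epsilon> where f: "\<And>n. f n \<in> F" "\<And>n. norm (f n) \<le> 2" "0 < \<epsilon>" "\<And>n. \<epsilon> \<le> norm (f n)"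
      "\<And>x. (\<lambda>n. blinfun_apply (f n) x) \<longlonglongrightarrow> 0"
      using weak_star_null_bounded_below_sequence[OF assms(2) F assms(4)] by blast
    obtain x where x: "apply_bcontfun x = f" by (rule bounded_sequence_as_bcontfun[OF f(2)])
    have "\<not> f \<longlonglongrightarrow> 0"
    proof
      assume "f \<longlonglongrightarrow> 0"
      then obtain n where "norm (f n) < \<epsilon>" using LIMSEQ_D[OF _ f(3), of f 0] by auto
      with f(4)[of n] show False by simp
    qed
    then have "x \<in> C" using f(1,5) by (auto simp: C_iff x linf_def)
    then show ?thesis by blast
  qed
  moreover have "C \<subseteq> linf F" by (auto simp: C_def)
  moreover have "\<exists>W. closed_subspace_of linf_scale (linf F) W \<and> infinite_dimensional linf_scale W \<and>
        W \<subseteq> C \<union> {0} \<and>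
        (\<exists>w\<in>W. \<exists>r :: nat \<Rightarrow> nat. strict_mono r \<and> apply_bcontfun w = apply_bcontfun x \<circ> r)" if "x \<in> C" for x
  proof -
    have x: "x \<in> linf F" "\<And>e. (\<lambda>n. blinfun_apply (apply_bcontfun x n) e) \<longlonglongrightarrow> 0" "\<not> apply_bcontfun x \<longlonglongrightarrow> 0"
      using \<open>x \<in> C\<close> by (simp_all add: C_iff)
    show ?thesis
    proof (rule spaceable_subsequence[OF F(1) x])
      fix W w and r :: "nat \<Rightarrow> nat"
      assume W: "closed_subspace_of linf_scale (linf F) W" "infinite_dimensional linf_scale W"
        "\<And>z e. z \<in> W \<Longrightarrow> (\<lambda>n. blinfun_apply (apply_bcontfun z n) e) \<longlonglongrightarrow> 0"
        "\<And>z. z \<in> W \<Longrightarrow> z \<noteq> 0 \<Longrightarrow> \<not> apply_bcontfun z \<longlonglongrightarrow> 0"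
        and w: "w \<in> W" "strict_mono r" "apply_bcontfun w = apply_bcontfun x \<circ> r"
      have "W \<subseteq> linf F" using W(1) by (simp add: closed_subspace_of_def)
      have "z \<in> C" if "z \<in> W" "z \<noteq> 0" for z
        unfolding C_iff using \<open>W \<subseteq> linf F\<close> W(3)[OF that(1)] W(4)[OF that] that(1) by blast
      then have "W \<subseteq> C \<union> {0}" by blast
      then show ?thesis using W(1,2) w by blast
    qed
  qed
  ultimately show ?thesis
    unfolding almost_pointwise_spaceable_def C_def[symmetric] by blast
qed

end
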